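(* Let $k:\mathbb{R}^d\times\mathbb{R}^d\to\mathbb{R}$ be given by $k(\mathbf{x},\mathbf{y})=\psi(\mathbf{x}-\mathbf{y})$, where $\psi:\mathbb{R}^d\to\mathbb{R}$ is bounded, continuous and positive definite with $\psi(0)=1$, and let $\Lambda$ be the associated Borel probability measure on $\mathbb{R}^d$. Let $\mathbf{p},\mathbf{q}\in\mathbb{N}^d$ and, for multi-indices $\mathbf{a},\mathbf{b}\in\mathbb{N}^d$, put $$T_{\mathbf{a},\mathbf{b}}:=\sup_{\boldsymbol{\omega}\in\mathrm{supp}(\Lambda)}|\boldsymbol{\omega}^{\mathbf{a}+\mathbf{b}}|,\qquad C_{\mathbf{a},\mathbf{b}}:=\mathbb{E}_{\boldsymbol{\omega}\sim\Lambda}\left[|\boldsymbol{\omega}^{\mathbf{a}+\mathbf{b}}|\,\|\boldsymbol{\omega}\|_2^2\right].$$ Assume that $C_{2\mathbf{p},2\mathbf{q}}<\infty$, that $T_{2\mathbf{p},2\mathbf{q}}>0$, and that $\mathrm{supp}(\Lambda)$ is bounded if $\mathbf{p}\ne\mathbf{0}$ or $\mathbf{q}\ne\mathbf{0}$. Let $m\ge1$ and let $s^{\mathbf{p},\mathbf{q}}$ be the random feature approximation of $\partial^{\mathbf{p},\mathbf{q}}k$ built from $(\boldsymbol{\omega}_i)_{i=1}^m$ drawn i.i.d. from $\Lambda$. Then for any $\tau>0$ and any non-empty compact set $S\subset\mathbb{R}^d$, $$\Lambda^m\left(\left\{(\boldsymbol{\omega}_i)_{i=1}^m:\ \|\partial^{\mathbf{p},\mathbf{q}}k-s^{\mathbf{p},\mathbf{q}}\|_{S\times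 S}\ \ge\ \frac{H(d,\mathbf{p},\mathbf{q},|S|)+T_{\mathbf{p},\mathbf{q}}\sqrt{2\tau}}{\sqrt m}\right\}\right)\le e^{-\tau},$$ where $$H(d,\mathbf{p},\mathbf{q},|S|)=32\sqrt{2d\,T_{2\mathbf{p},2\mathbf{q}}}\left[\sqrt{U(\mathbf{p},\mathbf{q},|S|)}+\frac{1}{2\sqrt{U(\mathbf{p},\mathbf{q},|S|)}}+\sqrt{\log\left(\sqrt{C_{2\mathbf{p},2\mathbf{q}}}+1\right)}\right],$$ $$U(\mathbf{p},\mathbf{q},|S|)=\log\left(2|S|\,T_{2\mathbf{p},2\mathbf{q}}^{-1/2}+1\right).$$
   Context: Here $d\ge1$, $\mathbb{N}=\{0,1,2,\dots\}$, and $\log$ is the natural logarithm. By Bochner's theorem, a bounded continuous positive definite $\psi:\mathbb{R}^d\to\mathbb{R}$ with $\psi(0)=1$ is the Fourier transform of a unique Borel probability measure $\Lambda$ on $\mathbb{R}^d$: $\psi(\mathbf{z})=\int e^{\sqrt{-1}\,\boldsymbol{\omega}^T\mathbf{z}}\,d\Lambda(\boldsymbol{\omega})=\int\cos(\boldsymbol{\omega}^T\mathbf{z})\,d\Lambda(\boldsymbol{\omega})$. $\mathrm{supp}(\Lambda)$ is the support of $\Lambda$ and $\Lambda^m$ is the $m$-fold product measure. For a multi-index $\mathbf{p}$: $|\mathbf{p}|=\sum_j p_j$ and $\mathbf{v}^{\mathbf{p}}=\prod_{j=1}^d v_j^{p_j}$ (with $0^0=1$). The derivative is $\partial^{\mathbf{p},\mathbf{q}}k(\mathbf{x},\mathbf{y})=\frac{\partial^{|\mathbf{p}|+|\mathbf{q}|}k(\mathbf{x},\mathbf{y})}{\partial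 x_1^{p_1}\cdots\partial x_d^{p_d}\,\partial y_1^{q_1}\cdots\partial y_d^{q_d}}$. For $a\in\mathbb{N}$ let $h_a(t)=\cos(\frac{\pi a}{2}+t)$. When $\int|\boldsymbol{\omega}^{\mathbf{p}+\mathbf{q}}|\,d\Lambda<\infty$ one has $\partial^{\mathbf{p},\mathbf{q}}k(\mathbf{x},\mathbf{y})=\int\boldsymbol{\omega}^{\mathbf{p}}(-\boldsymbol{\omega})^{\mathbf{q}}h_{|\mathbf{p}+\mathbf{q}|}(\boldsymbol{\omega}^T(\mathbf{x}-\mathbf{y}))\,d\Lambda(\boldsymbol{\omega})$. The approximation is $$s^{\mathbf{p},\mathbf{q}}(\mathbf{x},\mathbf{y})=\frac1m\sum_{j=1}^m\boldsymbol{\omega}_j^{\mathbf{p}}(-\boldsymbol{\omega}_j)^{\mathbf{q}}h_{|\mathbf{p}+\mathbf{q}|}(\boldsymbol{\omega}_j^T(\mathbf{x}-\mathbf{y})).$$ $|S|=\sup\{\|\mathbf{x}-\mathbf{y}\|_2:\mathbf{x},\mathbf{y}\in S\}$ is the Euclidean diameter and $\|f\|_{S\times S}=\sup_{\mathbf{x},\mathbf{y}\in S}|f(\mathbf{x},\mathbf{y})|$. If $|S|=0$ (so $U=0$), then $1/(2\sqrt U)$ is read as $+\infty$, so $H=+\infty$. *)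

theory Defs
  imports "HOL-Probability.Probability"
begin

text \<open>
  The ambient space is \<open>real ^ 'n\<close> with \<open>d = CARD('n)\<close>; multi-indices are vectors in \<open>nat ^ 'n\<close>,
  with componentwise addition and doubling. The coordinate type is linearly ordered only to fix
  the order of the partial derivatives in \<open>multi_partial\<close>.
\<close>

text \<open>Membership in the nonnegative reals demands that the complex sum be real.\<close>

definition pos_def :: "('a::ab_group_add \<Rightarrow> real) \<Rightarrow> bool" where
  "pos_def \<psi> \<longleftrightarrow>
     (\<forall>(N::nat) (z :: nat \<Rightarrow> 'a) (c :: nat \<Rightarrow> complex).
        (\<Sum>i<N. \<Sum>j<N. c i * cnj (c j) * complex_of_real (\<psi> (z i - z j))) \<in> \<real>\<^sub>\<ge>\<^sub>0)"

text \<open>By Bochner's theorem such a measure exists and is unique when \<open>\<psi>\<close> is bounded, continuous,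
  positive definite and \<open>\<psi> 0 = 1\<close>.\<close>

definition bochner_measure :: "('a::euclidean_space \<Rightarrow> real) \<Rightarrow> 'a measure \<Rightarrow> bool" where
  "bochner_measure \<psi> \<Lambda> \<longleftrightarrow>
     prob_space \<Lambda> \<and> sets \<Lambda> = sets borel \<and>
     (\<forall>z. complex_of_real (\<psi> z) = (\<integral>\<omega>. exp (\<i> * complex_of_real (\<omega> \<bullet> z)) \<partial>\<Lambda>))"

definition msupp :: "'a::topological_space measure \<Rightarrow> 'a set" where
  "msupp \<Lambda> = {x. \<forall>V. open V \<and> x \<in> V \<longrightarrow> emeasure \<Lambda> V > 0}"

definition mi_size :: "nat ^ 'n \<Rightarrow> nat" where
  "mi_size p = (\<Sum>j\<in>UNIV. p $ j)"

definition mi_pow :: "real ^ 'n \<Rightarrow> nat ^ 'n \<Rightarrow> real" where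
  "mi_pow v p = (\<Prod>j\<in>UNIV. (v $ j) ^ (p $ j))"

definition partial :: "'n \<Rightarrow> (real ^ 'n \<Rightarrow> real) \<Rightarrow> real ^ 'n \<Rightarrow> real" where
  "partial i f x = deriv (\<lambda>t. f (x + t *\<^sub>R axis i 1)) 0"

text \<open>The derivative in the first coordinate is outermost, as in the usual notation
  for mixed partial derivatives.\<close>

definition multi_partial ::
    "nat ^ 'n::{finite,linorder} \<Rightarrow> (real ^ 'n::{finite,linorder} \<Rightarrow> real) \<Rightarrow> real ^ 'n::{finite,linorder} \<Rightarrow> real" where
  "multi_partial p f = foldr (\<lambda>i. partial i ^^ (p $ i)) (sorted_list_of_set UNIV) f"

definition kernel_partial ::
    "nat ^ 'n::{finite,linorder} \<Rightarrow> nat ^ 'n::{finite,linorder} \<Rightarrow> (real ^ 'n::{finite,linorder} \<Rightarrow> real ^ 'n::{finite,linorder} \<Rightarrow> real)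
      \<Rightarrow> real ^ 'n::{finite,linorder} \<Rightarrow> real ^ 'n::{finite,linorder} \<Rightarrow> real" where
  "kernel_partial p q k x y = multi_partial p (\<lambda>x'. multi_partial q (\<lambda>y'. k x' y') y) x"

definition h_fun :: "nat \<Rightarrow> real \<Rightarrow> real" where
  "h_fun a t = cos (pi * real a / 2 + t)"

definition rff ::
    "nat \<Rightarrow> nat ^ 'n \<Rightarrow> nat ^ 'n \<Rightarrow> (nat \<Rightarrow> real ^ 'n) \<Rightarrow> real ^ 'n \<Rightarrow> real ^ 'n \<Rightarrow> real" where
  "rff m p q \<omega> x y =
     1 / real m * (\<Sum>j<m. mi_pow (\<omega> j) p * mi_pow (- \<omega> j) q
                            * h_fun (mi_size (p + q)) (\<omega> j \<bullet> (x - y)))"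

text \<open>A supremum in the reals, hence meaningful only for a function bounded on \<open>S \<times> S\<close>.\<close>

definition sup_norm :: "'a set \<Rightarrow> ('a \<Rightarrow> 'a \<Rightarrow> real) \<Rightarrow> real" where
  "sup_norm S f = (SUP (x, y)\<in>S \<times> S. \<bar>f x y\<bar>)"

text \<open>Both \<open>T_const\<close> (a real supremum) and \<open>C_const\<close> (a Bochner integral) are meaningful only when
  finite: for \<open>T_const\<close> it suffices that \<open>a + b = 0\<close> or that \<open>msupp \<Lambda>\<close> is bounded.\<close>

definition T_const :: "(real ^ 'n) measure \<Rightarrow> nat ^ 'n \<Rightarrow> nat ^ 'n \<Rightarrow> real" where
  "T_const \<Lambda> a b = (SUP \<omega>\<in>msupp \<Lambda>. \<bar>mi_pow \<omega> (a + b)\<bar>)"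

definition C_const :: "(real ^ 'n) measure \<Rightarrow> nat ^ 'n \<Rightarrow> nat ^ 'n \<Rightarrow> real" where
  "C_const \<Lambda> a b = (\<integral>\<omega>. \<bar>mi_pow \<omega> (a + b)\<bar> * (norm \<omega>)\<^sup>2 \<partial>\<Lambda>)"

definition U_const :: "(real ^ 'n) measure \<Rightarrow> nat ^ 'n \<Rightarrow> nat ^ 'n \<Rightarrow> real \<Rightarrow> real" where
  "U_const \<Lambda> p q r = ln (2 * r * T_const \<Lambda> (2 * p) (2 * q) powr (- 1 / 2) + 1)"

text \<open>The value is extended real because \<open>1 / 0 = \<infinity>\<close> there, as wanted when \<open>U_const\<close> vanishes.\<close>

definition H_const :: "(real ^ 'n) measure \<Rightarrow> nat ^ 'n \<Rightarrow> nat ^ 'n \<Rightarrow> real \<Rightarrow> ereal" where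
  "H_const \<Lambda> p q r =
     ereal (32 * sqrt (2 * real CARD('n) * T_const \<Lambda> (2 * p) (2 * q))) *
     (ereal (sqrt (U_const \<Lambda> p q r))
      + 1 / ereal (2 * sqrt (U_const \<Lambda> p q r))
      + ereal (sqrt (ln (sqrt (C_const \<Lambda> (2 * p) (2 * q)) + 1))))"

end

theory Submission
  imports Defs
begin

text \<open>
  On the support of \<open>\<Lambda>\<close> every feature is bounded by \<open>T_const \<Lambda> p q\<close>, so McDiarmid's
  inequality reduces the claim to bounding the expected uniform deviation by \<open>H / sqrt m\<close>.
  Symmetrization turns that expectation into one over random signs. Conditionally on the
  frequencies the signed sums are sub-Gaussian, with increments controlled by the Euclidean
  distance times \<open>L\<close>, the root mean square of \<open>\<bar>w \<omega>\<bar> * norm \<omega>\<close> over the sample, where \<open>w\<close> is the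
  amplitude of the features. Chaining over nets of a ball of radius \<open>diameter S\<close> at the scales
  \<open>T / (1 + L) / 2 ^ k\<close> gives entropies of at most \<open>d * (U + ln (1 + L) + k * ln 2)\<close>, and
  \<open>sqrt (U + x) \<le> sqrt U + x / (2 * sqrt U)\<close> produces the term \<open>1 / (2 * sqrt U)\<close>. Finally \<open>L\<close> is
  averaged by concavity of \<open>\<lambda>c. sqrt (ln (1 + sqrt c))\<close>.
\<close>

section \<open>Nets of balls\<close>

text \<open>The kernel derivative and its approximation depend on \<open>x - y\<close> alone, so the
  process is indexed by the differences of points of \<open>S\<close>, a subset of a ball in
  dimension d; this is why the entropy carries d and not twice d. The nets are taken in the whole
  ball: there a volume comparison gives an explicit cardinality, and the features make sense at
  every point.

  The obstacle is the random \<open>L\<close>: the bound may depend on it only through its mean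
  square, which is \<open>C\<close>. With scales proportional to \<open>1 / (1 + L)\<close>, the
  increments at level \<open>k\<close> stay below \<open>T * sqrt m / 2 ^ k\<close> whatever
  \<open>L\<close> is, and \<open>L\<close> survives only through \<open>ln (1 + L)\<close> under a
  square root. The price is that the nets depend on the sample, which is harmless because the
  chaining is done conditionally on it, for the signs alone.

  The deviation term \<open>T * sqrt (2 * \<tau>)\<close> is McDiarmid's inequality for a supremum
  that moves by at most \<open>2 * T\<close> when one frequency is replaced, before division by
  \<open>m\<close>.\<close>

lemma card_separated_cball:
  fixes P :: "'a::euclidean_space set"
  assumes "finite P" "P \<subseteq> cball 0 r" "0 \<le> r" "0 < \<delta>"
    and sep: "\<And>x y. x \<in> P \<Longrightarrow> y \<in> P \<Longrightarrow> x \<noteq> y \<Longrightarrow> \<delta> < dist x y"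
  shows "real (card P) \<le> (1 + 2 * r / \<delta>) ^ DIM('a)"
proof -
  let ?c = "measure lborel (ball (0::'a) 1)"
  have "0 < ?c"
    by (rule content_ball_pos) simp
  \<comment> \<open>The balls of radius \<open>\<delta> / 2\<close> around the separated points are
    disjoint and fit into the ball of radius \<open>r + \<delta> / 2\<close>. Comparing volumes, the
    unit ball cancels.\<close>
  have "real (card P) * ((\<delta> / 2) ^ DIM('a) * ?c) = (\<Sum>x\<in>P. measure lborel (ball x (\<delta> / 2)))"
    using \<open>0 < \<delta>\<close> by (simp add: content_ball_conv_unit_ball[of "\<delta> / 2"])
  also have "\<dots> = measure lborel (\<Union>x\<in>P. ball x (\<delta> / 2))"
  proof (rule measure_finite_Union[symmetric])
    show "disjoint_family_on (\<lambda>x. ball x (\<delta> / 2)) P"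
    proof (unfold disjoint_family_on_def, intro ballI impI equals0I)
      fix x y z assume "x \<in> P" "y \<in> P" "x \<noteq> y" "z \<in> ball x (\<delta> / 2) \<inter> ball y (\<delta> / 2)"
      then show False
        using sep[of x y] dist_triangle_half_l[of x z \<delta> y] by (auto simp: dist_commute)
    qed
  qed (use assms(1) emeasure_bounded_finite[OF bounded_ball] in \<open>auto simp: less_top\<close>)
  also have "\<dots> \<le> measure lborel (ball 0 (r + \<delta> / 2) :: 'a set)"
  proof (rule measure_mono_fmeasurable)
    show "(\<Union>x\<in>P. ball x (\<delta> / 2)) \<subseteq> ball 0 (r + \<delta> / 2)"
    proof safe
      fix x z assume "x \<in> P" "z \<in> ball x (\<delta> / 2)"
      then show "z \<in> ball 0 (r + \<delta> / 2)"
        using assms(2) dist_triangle[of 0 z x] by fastforce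
    qed
  qed (use emeasure_bounded_finite[OF bounded_ball] in \<open>auto intro!: fmeasurableI sets.countable_UN'' simp: countable_finite \<open>finite P\<close>\<close>)
  also have "\<dots> = (r + \<delta> / 2) ^ DIM('a) * ?c"
    using content_ball_conv_unit_ball[of "r + \<delta> / 2" "0::'a"] assms by simp
  finally have "real (card P) * (\<delta> / 2) ^ DIM('a) \<le> (r + \<delta> / 2) ^ DIM('a)"
    using \<open>0 < ?c\<close> by (simp add: mult.assoc[symmetric])
  then have "real (card P) \<le> (r + \<delta> / 2) ^ DIM('a) / (\<delta> / 2) ^ DIM('a)"
    using \<open>0 < \<delta>\<close> by (simp add: field_simps)
  also have "\<dots> = ((r + \<delta> / 2) / (\<delta> / 2)) ^ DIM('a)"
    by (simp only: power_divide)
  also have "(r + \<delta> / 2) / (\<delta> / 2) = 1 + 2 * r / \<delta>"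
    using \<open>0 < \<delta>\<close> by (simp add: field_simps)
  finally show ?thesis .
qed

text \<open>A separated set of largest cardinality is a net, since a point that it misses could be
  added to it. The volume bound caps the cardinalities, so a largest one exists.\<close>

lemma finite_net_cball:
  assumes "0 \<le> r" "0 < \<delta>"
  obtains P :: "'a::euclidean_space set"
  where "finite P" "P \<noteq> {}" "P \<subseteq> cball 0 r" "real (card P) \<le> (1 + 2 * r / \<delta>) ^ DIM('a)"
    "\<And>z. z \<in> cball 0 r \<Longrightarrow> \<exists>p\<in>P. dist z p \<le> \<delta>"
proof -
  define sep where "sep P \<longleftrightarrow> finite P \<and> P \<subseteq> cball 0 r \<and>
      (\<forall>x\<in>P. \<forall>y\<in>P. x \<noteq> y \<longrightarrow> \<delta> < dist x y)" for P :: "'a set"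
  have "sep {}"
    by (simp add: sep_def)
  moreover have "\<forall>P. sep P \<longrightarrow> card P < Suc (nat \<lfloor>(1 + 2 * r / \<delta>) ^ DIM('a)\<rfloor>)"
  proof safe
    fix P assume "sep P"
    then have "real (card P) \<le> (1 + 2 * r / \<delta>) ^ DIM('a)"
      using card_separated_cball assms unfolding sep_def by blast
    then show "card P < Suc (nat \<lfloor>(1 + 2 * r / \<delta>) ^ DIM('a)\<rfloor>)"
      by (simp add: le_nat_floor less_Suc_eq_le)
  qed
  ultimately obtain P where P: "sep P" and max: "\<And>Q. sep Q \<Longrightarrow> card Q \<le> card P"
    using ex_has_greatest_nat[of sep "{}" card] by blast
  have net: "\<exists>p\<in>P. dist z p \<le> \<delta>" if "z \<in> cball 0 r" for z
  proof (rule ccontr)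
    assume *: "\<not> (\<exists>p\<in>P. dist z p \<le> \<delta>)"
    then have "\<forall>p\<in>P. \<delta> < dist z p \<and> \<delta> < dist p z"
      by (auto simp: dist_commute)
    then have "sep (insert z P)"
      using P that unfolding sep_def by auto
    moreover have "z \<notin> P"
      using * assms by (metis dist_self less_imp_le)
    ultimately show False
      using max[of "insert z P"] P by (simp add: sep_def)
  qed
  show ?thesis
  proof
    show "P \<noteq> {}"
      using net[of 0] assms by auto
    show "real (card P) \<le> (1 + 2 * r / \<delta>) ^ DIM('a)"
      using P card_separated_cball assms unfolding sep_def by blast
  qed (use P net in \<open>auto simp: sep_def\<close>)
qed

section \<open>Random signs\<close>

text \<open>Random signs form a finite set rather than a probability space, so averages over them
  are finite sums and suprema inside raise no measurability question. \<open>PiE\<close> keeps the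
  set finite by fixing the values from \<open>m\<close> on.\<close>

definition signs :: "nat \<Rightarrow> (nat \<Rightarrow> real) set" where
  "signs m = PiE {..<m} (\<lambda>_. {-1, 1})"

definition sign_avg :: "nat \<Rightarrow> ((nat \<Rightarrow> real) \<Rightarrow> real) \<Rightarrow> real" where
  "sign_avg m F = (\<Sum>s\<in>signs m. F s) / 2 ^ m"

lemma card_signs: "card (signs m) = 2 ^ m"
  by (simp add: signs_def card_PiE numeral_2_eq_2)

lemma signs_abs: "s \<in> signs m \<Longrightarrow> j < m \<Longrightarrow> \<bar>s j\<bar> = 1"
  unfolding signs_def by (drule PiE_mem[where x = j]) auto

lemma sign_avg_const [simp]: "sign_avg m (\<lambda>_. c) = c"
  by (simp add: sign_avg_def card_signs)

lemma sign_avg_mono: "(\<And>s. s \<in> signs m \<Longrightarrow> F s \<le> G s) \<Longrightarrow> sign_avg m F \<le> sign_avg m G"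
  by (simp add: sign_avg_def sum_mono divide_right_mono)

lemma sign_avg_cong: "(\<And>s. s \<in> signs m \<Longrightarrow> F s = G s) \<Longrightarrow> sign_avg m F = sign_avg m G"
  by (simp add: sign_avg_def)

lemma sign_avg_add: "sign_avg m (\<lambda>s. F s + G s) = sign_avg m F + sign_avg m G"
  by (simp add: sign_avg_def sum.distrib add_divide_distrib)

lemma sign_avg_cmult: "sign_avg m (\<lambda>s. c * F s) = c * sign_avg m F"
  by (simp add: sign_avg_def sum_distrib_left)

lemma sign_avg_sum: "sign_avg m (\<lambda>s. \<Sum>i\<in>I. F i s) = (\<Sum>i\<in>I. sign_avg m (F i))"
  unfolding sign_avg_def sum_divide_distrib[symmetric] by (subst sum.swap) (rule refl)

text \<open>Conditioning on the last sign, which drives the inductions over the number of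
  signs.\<close>

lemma sign_avg_Suc:
  "sign_avg (Suc m) F = (sign_avg m (\<lambda>s. F (s(m := 1))) + sign_avg m (\<lambda>s. F (s(m := -1)))) / 2"
proof -
  have "signs (Suc m) = (\<lambda>(x, s). s(m := x)) ` ({-1, 1} \<times> signs m)"
    by (simp add: signs_def lessThan_Suc PiE_insert_eq)
  moreover have "inj_on (\<lambda>(x, s). s(m := x)) ({-1, 1} \<times> signs m)"
    unfolding signs_def by (rule inj_combinator) simp
  ultimately have "(\<Sum>s\<in>signs (Suc m). F s) = (\<Sum>x\<in>{-1, 1}. \<Sum>s\<in>signs m. F (s(m := x)))"
    by (simp add: sum.reindex sum.cartesian_product case_prod_unfold)
  then show ?thesis
    by (simp add: sign_avg_def add_divide_distrib)
qed

text \<open>Hoeffding's scalar inequality at probability \<open>1 / 2\<close> and argument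
  \<open>2 * y\<close>, where its left-hand side becomes \<open>ln (cosh y)\<close>. That argument
  must be nonnegative, hence \<open>y = \<bar>x\<bar>\<close>.\<close>

lemma cosh_le_exp_half_square: "cosh x \<le> exp (x\<^sup>2 / 2)" for x :: real
proof -
  define y where "y = \<bar>x\<bar>"
  have "1 + 1 / 2 * (exp (2 * y) - 1) = exp y * cosh y"
    by (simp add: cosh_def exp_add[symmetric] distrib_left diff_divide_distrib add_divide_distrib)
  then have "- (2 * y) * (1 / 2) + ln (exp y * cosh y) \<le> (2 * y)\<^sup>2 / 8"
    using Hoeffdings_lemma_aux[of "2 * y" "1 / 2"] by (simp add: y_def)
  also have "ln (exp y * cosh y) = y + ln (cosh y)"
    by (subst ln_mult) auto
  finally have "ln (cosh y) \<le> y\<^sup>2 / 2"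
    by (simp add: power_mult_distrib)
  then have "exp (ln (cosh y)) \<le> exp (y\<^sup>2 / 2)"
    by (rule exp_le_cancel_iff[THEN iffD2])
  then have "cosh y \<le> exp (y\<^sup>2 / 2)"
    unfolding exp_ln[OF cosh_real_pos] .
  then show ?thesis
    by (simp add: y_def abs_if split: if_splits)
qed

text \<open>Rademacher sums are sub-Gaussian: each sign contributes its own factor
  \<open>cosh (l * a j)\<close>.\<close>

lemma sign_avg_exp_le:
  "sign_avg m (\<lambda>s. exp (l * (\<Sum>j<m. s j * a j))) \<le> exp (l\<^sup>2 * (\<Sum>j<m. (a j)\<^sup>2) / 2)"
proof (induction m)
  case 0
  then show ?case by simp
next
  case (Suc m)
  let ?E = "\<lambda>s. exp (l * (\<Sum>j<m. s j * a j))"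
  have "sign_avg (Suc m) (\<lambda>s. exp (l * (\<Sum>j<Suc m. s j * a j))) =
      (sign_avg m (\<lambda>s. exp (l * a m) * ?E s) + sign_avg m (\<lambda>s. exp (- (l * a m)) * ?E s)) / 2"
    by (simp add: sign_avg_Suc distrib_left exp_add[symmetric] add.commute)
  also have "\<dots> = cosh (l * a m) * sign_avg m ?E"
    by (simp add: sign_avg_cmult cosh_def distrib_right add_divide_distrib)
  also have "\<dots> \<le> exp ((l * a m)\<^sup>2 / 2) * exp (l\<^sup>2 * (\<Sum>j<m. (a j)\<^sup>2) / 2)"
    by (intro mult_mono cosh_le_exp_half_square Suc) (auto simp: sign_avg_def intro!: sum_nonneg divide_nonneg_nonneg)
  also have "\<dots> = exp (l\<^sup>2 * (\<Sum>j<Suc m. (a j)\<^sup>2) / 2)"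
    by (simp add: exp_add[symmetric] power_mult_distrib distrib_left add_divide_distrib)
  finally show ?case .
qed

text \<open>Maximal inequality for finitely many sub-Gaussian sums: the maximum is at most
  \<open>ln E / l\<close>, where \<open>E\<close> adds up the exponentials of all
  \<open>l * Y s i\<close> and of their negatives. Including the negatives handles the absolute
  values and doubles the family, whence the 2 next to \<open>card I\<close>.\<close>

lemma sign_avg_Max_le:
  assumes "finite I" "I \<noteq> {}" "0 < \<sigma>"
    and var: "\<And>i. i \<in> I \<Longrightarrow> (\<Sum>j<m. (a i j)\<^sup>2) \<le> \<sigma>\<^sup>2"
  shows "sign_avg m (\<lambda>s. Max ((\<lambda>i. \<bar>\<Sum>j<m. s j * a i j\<bar>) ` I)) \<le> \<sigma> * sqrt (2 * ln (2 * real (card I)))"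
proof -
  define Y where "Y s i = (\<Sum>j<m. s j * a i j)" for s i
  define R where "R = ln (2 * real (card I))"
  \<comment> \<open>This \<open>l\<close> minimizes \<open>R / l + l * \<sigma>\<^sup>2 / 2\<close>
    by making both terms equal. The number \<open>c\<close> below bounds the average of
    \<open>E\<close>; the tangent of \<open>ln\<close> at \<open>c\<close> replaces Jensen's
    inequality, because it is affine and can be averaged term by term.\<close>
  define l where "l = sqrt (2 * R) / \<sigma>"
  define c where "c = 2 * real (card I) * exp (l\<^sup>2 * \<sigma>\<^sup>2 / 2)"
  have card: "1 \<le> card I"
    using assms by (simp add: Suc_le_eq card_gt_0_iff)
  then have "0 < R" "0 < c"
    by (auto simp: R_def c_def)
  then have "0 < l"
    using \<open>0 < \<sigma>\<close> by (simp add: l_def)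
  have l2: "l\<^sup>2 * \<sigma>\<^sup>2 / 2 = R"
    using \<open>0 < \<sigma>\<close> \<open>0 < R\<close> by (simp add: l_def power_divide)
  have le: "Max ((\<lambda>i. \<bar>Y s i\<bar>) ` I) \<le>
      1 / l * (ln c - 1 + 1 / c * (\<Sum>i\<in>I. exp (l * Y s i) + exp (- l * Y s i)))" for s
  proof -
    have "Max ((\<lambda>i. \<bar>Y s i\<bar>) ` I) \<in> (\<lambda>i. \<bar>Y s i\<bar>) ` I"
      using assms by (intro Max_in) auto
    then obtain i where i: "i \<in> I" "Max ((\<lambda>i. \<bar>Y s i\<bar>) ` I) = \<bar>Y s i\<bar>"
      by auto
    define E where "E = (\<Sum>i\<in>I. exp (l * Y s i) + exp (- l * Y s i))"
    have "exp (l * \<bar>Y s i\<bar>) \<le> exp (l * Y s i) + exp (- l * Y s i)"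
      by (cases "Y s i \<ge> 0") auto
    also have "\<dots> \<le> E"
      unfolding E_def using i assms by (intro member_le_sum) (auto intro: add_nonneg_nonneg)
    finally have E: "exp (l * \<bar>Y s i\<bar>) \<le> E" .
    then have "0 < E"
      using exp_gt_zero less_le_trans by blast
    have "l * \<bar>Y s i\<bar> \<le> ln E"
      using E \<open>0 < E\<close> by (metis ln_exp ln_le_cancel_iff exp_gt_zero)
    also have "\<dots> = ln c + ln (E / c)"
      using \<open>0 < c\<close> \<open>0 < E\<close> by (simp add: ln_div)
    also have "\<dots> \<le> ln c - 1 + 1 / c * E"
      using ln_le_minus_one[of "E / c"] \<open>0 < c\<close> \<open>0 < E\<close> by simp
    finally have "l * \<bar>Y s i\<bar> \<le> ln c - 1 + 1 / c * E" .
    then show ?thesis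
      using \<open>0 < l\<close> i(2) unfolding E_def[symmetric] by (simp add: field_simps)
  qed
  have mgf: "sign_avg m (\<lambda>s. exp (l' * Y s i)) \<le> exp (l\<^sup>2 * \<sigma>\<^sup>2 / 2)" if "i \<in> I" "l'\<^sup>2 = l\<^sup>2" for i l'
  proof -
    have "sign_avg m (\<lambda>s. exp (l' * Y s i)) \<le> exp (l'\<^sup>2 * (\<Sum>j<m. (a i j)\<^sup>2) / 2)"
      unfolding Y_def by (rule sign_avg_exp_le)
    also have "\<dots> \<le> exp (l\<^sup>2 * \<sigma>\<^sup>2 / 2)"
      using var[OF that(1)] that(2) by (simp add: mult_left_mono)
    finally show ?thesis .
  qed
  have "sign_avg m (\<lambda>s. Max ((\<lambda>i. \<bar>Y s i\<bar>) ` I)) \<le> 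
     sign_avg m (\<lambda>s. 1 / l * (ln c - 1 + 1 / c * (\<Sum>i\<in>I. exp (l * Y s i) + exp (- l * Y s i))))"
    by (intro sign_avg_mono le)
  also have "\<dots> = 1 / l * (ln c - 1 + 1 / c * (\<Sum>i\<in>I. sign_avg m (\<lambda>s. exp (l * Y s i)) + sign_avg m (\<lambda>s. exp (- l * Y s i))))"
    by (simp only: sign_avg_cmult sign_avg_add sign_avg_sum sign_avg_const)
  also have "\<dots> \<le> 1 / l * (ln c - 1 + 1 / c * (\<Sum>i\<in>I. exp (l\<^sup>2 * \<sigma>\<^sup>2 / 2) + exp (l\<^sup>2 * \<sigma>\<^sup>2 / 2)))"
    using \<open>0 < l\<close> \<open>0 < c\<close> by (intro mult_left_mono add_left_mono sum_mono add_mono mgf) auto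
  also have "\<dots> = 1 / l * ln c"
    using card by (simp add: c_def)
  also have "ln c = R + R"
    unfolding c_def l2 using card by (subst ln_mult) (auto simp: R_def)
  also have "1 / l * (R + R) = \<sigma> * (2 * R / sqrt (2 * R))"
    by (simp add: l_def)
  also have "\<dots> = \<sigma> * sqrt (2 * R)"
    using \<open>0 < R\<close> by (subst real_div_sqrt) auto
  finally show ?thesis
    by (simp add: Y_def R_def)
qed

section \<open>Chaining\<close>

text \<open>The arithmetic-geometric mean inequality for \<open>a\<close> and \<open>a + x\<close>.
  Negative \<open>x\<close> is allowed, so the tangent bounds the root on both sides of
  \<open>a\<close>.\<close>

lemma sqrt_add_le_tangent:
  fixes a x :: real
  assumes "0 < a" "0 \<le> a + x"
  shows "sqrt (a + x) \<le> sqrt a + x / (2 * sqrt a)"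
proof -
  have "2 * sqrt a * sqrt (a + x) \<le> a + (a + x)"
    using sum_squares_bound[of "sqrt a" "sqrt (a + x)"] assms by simp
  then have "2 * sqrt a * sqrt (a + x) \<le> 2 * (sqrt a * sqrt a) + x"
    using assms by simp
  then have "sqrt (a + x) \<le> (2 * (sqrt a * sqrt a) + x) / (2 * sqrt a)"
    using assms by (subst pos_le_divide_eq) (auto simp: mult_ac)
  also have "\<dots> = sqrt a + x / (2 * sqrt a)"
    using assms by (subst add_divide_distrib) (simp del: real_sqrt_mult_self)
  finally show ?thesis .
qed

text \<open>The scale at level \<open>k\<close> is finer than \<open>T\<close> by the factor
  \<open>B = (1 + L) * 2 ^ k\<close>, so the covering bound grows by at most the power
  \<open>B ^ d\<close>, and its logarithm splits into \<open>U\<close>, \<open>ln (1 + L)\<close>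
  and \<open>k * ln 2\<close>. Writing the result as \<open>k + 1\<close> times a quantity common to
  all levels reduces the chaining sum to explicit weights.\<close>

lemma net_entropy_le:
  fixes T r L U W :: real
  assumes "0 < T" "0 \<le> r" "0 \<le> L" "1 \<le> N" "1 \<le> d"
    and N: "real N \<le> (1 + 2 * r / (T / (1 + L) / 2 ^ k)) ^ d"
    and U: "U = ln (1 + 2 * r / T)" "0 < U"
    and W: "W = sqrt U + 1 / (2 * sqrt U) + sqrt (ln (1 + L))"
  shows "sqrt (2 * ln (2 * real N)) \<le> real (k + 1) * (sqrt (2 * real d) * W)"
proof -
  define x where "x = real (k + 1)"
  have L0: "0 \<le> ln (1 + L)"
    using assms by simp
  have r0: "0 \<le> 2 * r / T"
    using assms by simp
  define B where "B = (1 + L) * 2 ^ k"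
  have B: "1 \<le> B"
    unfolding B_def using assms one_le_power[of "2::real" k] mult_mono[of 1 "1 + L" 1 "2 ^ k"] by simp
  have "1 + 2 * r / (T / (1 + L) / 2 ^ k) = 1 + B * (2 * r / T)"
    by (simp add: B_def divide_simps)
  also have "\<dots> \<le> B * (1 + 2 * r / T)"
    using B by (simp add: distrib_left)
  finally have "(1 + 2 * r / (T / (1 + L) / 2 ^ k)) ^ d \<le> (B * (1 + 2 * r / T)) ^ d"
    using assms(1-3) by (intro power_mono add_nonneg_nonneg divide_nonneg_nonneg) auto
  with N have "real N \<le> (B * (1 + 2 * r / T)) ^ d"
    by (rule order_trans)
  then have "ln (real N) \<le> ln ((B * (1 + 2 * r / T)) ^ d)"
    using assms(4) by (intro ln_mono) auto
  also have "\<dots> = real d * ln (B * (1 + 2 * r / T))"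
    by (rule ln_realpow)
  also have "ln (B * (1 + 2 * r / T)) = ln B + U"
    unfolding U using B r0 by (intro ln_mult_pos) (auto intro: add_pos_nonneg)
  also have "ln B = ln (1 + L) + k * ln 2"
    unfolding B_def using assms by (subst ln_mult_pos) (auto simp: ln_realpow)
  finally have "ln (2 * real N) \<le> ln 2 + real d * (ln (1 + L) + k * ln 2 + U)"
    using assms(4) by (subst ln_mult_pos) auto
  \<comment> \<open>The factor 2 of the maximal inequality costs \<open>ln 2\<close>, which is at
    most \<open>d\<close>; together with \<open>k * ln 2\<close> it is absorbed into
    \<open>x = k + 1\<close>.\<close>
  moreover have "ln 2 \<le> real d"
    using ln_2_less_1 \<open>1 \<le> d\<close> by linarith
  moreover have "real d * (k * ln 2) \<le> real d * (real k * 1)"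
    using ln_2_less_1 by (intro mult_left_mono) auto
  ultimately have "2 * ln (2 * real N) \<le> 2 * real d * (U + x + ln (1 + L))"
    by (simp add: x_def algebra_simps)
  then have "sqrt (2 * ln (2 * real N)) \<le> sqrt (2 * real d) * sqrt (U + x + ln (1 + L))"
    by (metis real_sqrt_le_iff real_sqrt_mult)
  also have "sqrt (U + x + ln (1 + L)) \<le> x * W"
  proof -
    \<comment> \<open>Only \<open>x\<close> is expanded around \<open>U\<close>. Splitting
      \<open>ln (1 + L)\<close> off by subadditivity keeps it free of the factor
      \<open>1 / (2 * sqrt U)\<close>.\<close>
    have "sqrt (U + x + ln (1 + L)) \<le> sqrt (U + x) + sqrt (ln (1 + L))"
      using U L0 by (intro sqrt_add_le_add_sqrt) (auto simp: x_def)
    also have "sqrt (U + x) \<le> sqrt U + x / (2 * sqrt U)"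
      using U by (intro sqrt_add_le_tangent) (auto simp: x_def)
    also have "sqrt U + x / (2 * sqrt U) + sqrt (ln (1 + L)) \<le> x * sqrt U + x / (2 * sqrt U) + x * sqrt (ln (1 + L))"
    proof -
      have "t \<le> x * t" if "0 \<le> t" for t
        using mult_right_mono[of 1 x t] that by (simp add: x_def)
      then show ?thesis
        using U(2) L0 by (intro add_mono order_refl) (blast intro: real_sqrt_ge_zero less_imp_le)+
    qed
    finally show ?thesis
      by (simp add: W distrib_left)
  qed
  finally show ?thesis
    by (simp add: x_def mult.left_commute mult_left_mono)
qed

text \<open>A weight is the entropy factor \<open>k + 2\<close> of the net \<open>P (Suc k)\<close>
  times the decay \<open>1 / 2 ^ k\<close> of the increments. The closed form shows that the total
  stays below 6.\<close>

lemma sum_chaining_weights: "(\<Sum>k<K. (real k + 2) / 2 ^ k) = 6 - (2 * real K + 6) / 2 ^ K"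
proof (induction K)
  case (Suc K)
  then show ?case
    unfolding sum.lessThan_Suc Suc by (simp add: field_simps)
qed simp

lemma sign_sum_diff_le:
  assumes "s \<in> signs m"
  shows "\<bar>(\<Sum>j<m. s j * a j) - (\<Sum>j<m. s j * a' j)\<bar> \<le> (\<Sum>j<m. \<bar>a j - a' j\<bar>)"
proof -
  have "\<bar>(\<Sum>j<m. s j * a j) - (\<Sum>j<m. s j * a' j)\<bar> = \<bar>\<Sum>j<m. s j * (a j - a' j)\<bar>"
    by (simp add: sum_subtractf right_diff_distrib)
  also have "\<dots> \<le> (\<Sum>j<m. \<bar>s j * (a j - a' j)\<bar>)"
    by (rule sum_abs)
  also have "\<dots> = (\<Sum>j<m. \<bar>a j - a' j\<bar>)"
    using assms by (intro sum.cong) (auto simp: abs_mult signs_abs)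
  finally show ?thesis .
qed

text \<open>Dudley's chaining, conditionally on the frequencies \<open>u\<close>: a point of
  \<open>D\<close> is joined to the coarsest net through close net points at halving scales, and
  each level costs one finite maximum of signed sums.\<close>

lemma sign_avg_SUP_chaining:
  fixes u :: "nat \<Rightarrow> 'a::euclidean_space" and b :: "nat \<Rightarrow> real" and h :: "real \<Rightarrow> real"
  assumes "0 < m" "0 < T" "0 \<le> r"
    and D: "D \<subseteq> cball 0 r" "D \<noteq> {}"
    and lip: "\<And>x y. \<bar>h x - h y\<bar> \<le> \<bar>x - y\<bar>" and h1: "\<And>x. \<bar>h x\<bar> \<le> 1"
    and bT: "\<And>j. j < m \<Longrightarrow> \<bar>b j\<bar> \<le> T"
    and U: "U = ln (1 + 2 * r / T)" "0 < U"
    and L: "L = sqrt ((\<Sum>j<m. (b j)\<^sup>2 * (norm (u j))\<^sup>2) / real m)"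
    and W: "W = sqrt U + 1 / (2 * sqrt U) + sqrt (ln (1 + L))"
  shows "sign_avg m (\<lambda>s. SUP z\<in>D. \<bar>\<Sum>j<m. s j * (b j * h (u j \<bullet> z))\<bar>)
           \<le> 7 * (T * sqrt m * (sqrt (2 * real DIM('a)) * W))"
proof -
  define a where "a z j = b j * h (u j \<bullet> z)" for z j
  define V where "V s z = (\<Sum>j<m. s j * a z j)" for s z
  \<comment> \<open>Moving by \<open>\<delta> k\<close> changes the coefficient vector by at most
    \<open>sqrt m * L * \<delta> k\<close> in Euclidean norm, hence by at most
    \<open>T * sqrt m / 2 ^ k\<close>, in proportion to the bound \<open>T * sqrt m\<close> on the
    vector itself. The summand 1 keeps the scale meaningful when \<open>L = 0\<close>.\<close>
  define \<delta> where "\<delta> k = T / (1 + L) / 2 ^ k" for k :: nat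
  \<comment> \<open>A crude Lipschitz constant, valid for every choice of signs. It serves for the
    step from a point of \<open>D\<close> to the finest net, where it is multiplied by a mesh that
    tends to 0.\<close>
  define M where "M = (\<Sum>j<m. \<bar>b j\<bar> * norm (u j))"
  define Q where "Q = T * sqrt m * (sqrt (2 * real DIM('a)) * W)"
  have L0: "0 \<le> L"
    unfolding L by (intro real_sqrt_ge_zero divide_nonneg_nonneg sum_nonneg) auto
  have \<delta>0: "0 < \<delta> k" for k
    using L0 \<open>0 < T\<close> by (simp add: \<delta>_def)
  have "0 \<le> W"
    unfolding W using U L0 by (intro add_nonneg_nonneg) auto
  then have "0 \<le> Q"
    unfolding Q_def using \<open>0 < T\<close> by (intro mult_nonneg_nonneg) auto
  have M0: "0 \<le> M"
    by (auto simp: M_def intro!: sum_nonneg)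
  have a_diff: "\<bar>a z j - a z' j\<bar> \<le> \<bar>b j\<bar> * norm (u j) * dist z z'" for z z' j
  proof -
    have "\<bar>a z j - a z' j\<bar> = \<bar>b j\<bar> * \<bar>h (u j \<bullet> z) - h (u j \<bullet> z')\<bar>"
      by (simp add: a_def right_diff_distrib[symmetric] abs_mult)
    also have "\<bar>h (u j \<bullet> z) - h (u j \<bullet> z')\<bar> \<le> norm (u j) * dist z z'"
      using lip[of "u j \<bullet> z" "u j \<bullet> z'"] Cauchy_Schwarz_ineq2[of "u j" "z - z'"]
      by (simp add: inner_diff_right dist_norm)
    finally show ?thesis
      by (simp add: mult.assoc mult_left_mono)
  qed
  have V_diff: "\<bar>V s z - V s z'\<bar> \<le> M * dist z z'" if "s \<in> signs m" for s z z'
  proof -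
    have "\<bar>V s z - V s z'\<bar> \<le> (\<Sum>j<m. \<bar>a z j - a z' j\<bar>)"
      unfolding V_def using that by (rule sign_sum_diff_le)
    also have "\<dots> \<le> M * dist z z'"
      unfolding M_def sum_distrib_right by (intro sum_mono a_diff)
    finally show ?thesis .
  qed
  have "\<exists>P::'a set. finite P \<and> P \<noteq> {} \<and> P \<subseteq> cball 0 r \<and>
      real (card P) \<le> (1 + 2 * r / \<delta> k) ^ DIM('a) \<and> (\<forall>z\<in>cball 0 r. \<exists>p\<in>P. dist z p \<le> \<delta> k)" for k
    using finite_net_cball[OF \<open>0 \<le> r\<close> \<delta>0[of k]] by metis
  then obtain P :: "nat \<Rightarrow> 'a set" where fin: "\<And>k. finite (P k)" and ne: "\<And>k. P k \<noteq> {}"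
    and sub: "\<And>k. P k \<subseteq> cball 0 r"
    and card: "\<And>k. real (card (P k)) \<le> (1 + 2 * r / \<delta> k) ^ DIM('a)"
    and net: "\<And>k z. z \<in> cball 0 r \<Longrightarrow> \<exists>p\<in>P k. dist z p \<le> \<delta> k"
    by metis
  define \<pi> where "\<pi> k z = (SOME p. p \<in> P k \<and> dist z p \<le> \<delta> k)" for k z
  have \<pi>: "\<pi> k z \<in> P k" "dist z (\<pi> k z) \<le> \<delta> k" if "z \<in> cball 0 r" for k z
    using someI_ex[OF net[OF that, unfolded Bex_def]] unfolding \<pi>_def by blast+
  have entropy: "sqrt (2 * ln (2 * real (card (P k)))) \<le> real (k + 1) * (sqrt (2 * real DIM('a)) * W)" for k
    using assms(2,3) L0 fin[of k] ne[of k] card[of k] U W unfolding \<delta>_def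
    by (intro net_entropy_le) (auto simp: Suc_le_eq card_gt_0_iff)

  define X where "X s = Max ((\<lambda>p. \<bar>V s p\<bar>) ` P 0)" for s
  \<comment> \<open>The link from a net point \<open>p\<close> depends on \<open>p\<close> alone,
    not on the point of \<open>D\<close> being approximated. So level \<open>k\<close> has as many
    links as \<open>P (Suc k)\<close> has points, and the entropy of that one net suffices; the
    weight \<open>k + 2\<close> is \<open>Suc k + 1\<close>.\<close>
  define Y where "Y k s = Max ((\<lambda>p. \<bar>V s p - V s (\<pi> k p)\<bar>) ` P (Suc k))" for k s
  have X_avg: "sign_avg m X \<le> Q"
  proof -
    have "sign_avg m X \<le> T * sqrt m * sqrt (2 * ln (2 * real (card (P 0))))"
      unfolding X_def V_def
    proof (rule sign_avg_Max_le)
      show "(\<Sum>j<m. (a p j)\<^sup>2) \<le> (T * sqrt m)\<^sup>2" for p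
      proof -
        have "(a p j)\<^sup>2 \<le> T\<^sup>2" if "j < m" for j
          using mult_mono[OF bT[OF that] h1[of "u j \<bullet> p"]] \<open>0 < T\<close>
          by (intro abs_le_square_iff[THEN iffD1]) (simp add: a_def abs_mult)
        then have "(\<Sum>j<m. (a p j)\<^sup>2) \<le> (\<Sum>j<m. T\<^sup>2)"
          by (intro sum_mono) simp
        then show ?thesis
          by (simp add: power_mult_distrib mult.commute)
      qed
    qed (use fin ne assms in auto)
    also have "\<dots> \<le> Q"
      unfolding Q_def using entropy[of 0] assms(2) by (intro mult_left_mono) auto
    finally show ?thesis .
  qed
  have Y_avg: "sign_avg m (Y k) \<le> (real k + 2) / 2 ^ k * Q" for k
  proof -
    have "sign_avg m (\<lambda>s. Max ((\<lambda>p. \<bar>\<Sum>j<m. s j * (a p j - a (\<pi> k p) j)\<bar>) ` P (Suc k)))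
        \<le> T * sqrt m / 2 ^ k * sqrt (2 * ln (2 * real (card (P (Suc k)))))"
    proof (rule sign_avg_Max_le)
      show "(\<Sum>j<m. (a p j - a (\<pi> k p) j)\<^sup>2) \<le> (T * sqrt m / 2 ^ k)\<^sup>2" if "p \<in> P (Suc k)" for p
      proof -
        have "p \<in> cball 0 r"
          using that sub by blast
        then have dist: "dist p (\<pi> k p) \<le> \<delta> k"
          by (rule \<pi>)
        have "(a p j - a (\<pi> k p) j)\<^sup>2 \<le> (b j)\<^sup>2 * (norm (u j))\<^sup>2 * (\<delta> k)\<^sup>2" for j
        proof -
          have "\<bar>a p j - a (\<pi> k p) j\<bar> \<le> \<bar>b j\<bar> * norm (u j) * \<delta> k"
            using a_diff[of p j "\<pi> k p"] dist by (meson abs_ge_zero mult_left_mono mult_nonneg_nonneg norm_ge_zero order_trans)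
          then have "\<bar>a p j - a (\<pi> k p) j\<bar>\<^sup>2 \<le> (\<bar>b j\<bar> * norm (u j) * \<delta> k)\<^sup>2"
            by (intro power_mono) auto
          then show ?thesis
            by (simp add: power_mult_distrib)
        qed
        then have "(\<Sum>j<m. (a p j - a (\<pi> k p) j)\<^sup>2) \<le> (\<Sum>j<m. (b j)\<^sup>2 * (norm (u j))\<^sup>2 * (\<delta> k)\<^sup>2)"
          by (intro sum_mono)
        also have "\<dots> = m * (L * \<delta> k)\<^sup>2"
          using \<open>0 < m\<close> by (simp add: L power_mult_distrib sum_distrib_right[symmetric] sum_nonneg)
        also have "\<dots> \<le> m * (T / 2 ^ k)\<^sup>2"
        proof (intro mult_left_mono power_mono)
          have "L / (1 + L) * (T / 2 ^ k) \<le> 1 * (T / 2 ^ k)"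
            using L0 \<open>0 < T\<close> by (intro mult_right_mono) auto
          then show "L * \<delta> k \<le> T / 2 ^ k"
            by (simp add: \<delta>_def)
        qed (use L0 \<delta>0[of k] in auto)
        also have "\<dots> = (T * sqrt m / 2 ^ k)\<^sup>2"
          by (simp add: power_mult_distrib power_divide)
        finally show ?thesis .
      qed
    qed (use fin ne assms in auto)
    also have "\<dots> \<le> T * sqrt m / 2 ^ k * (real (Suc k + 1) * (sqrt (2 * real DIM('a)) * W))"
      using entropy[of "Suc k"] assms(2) by (intro mult_left_mono) auto
    also have "\<dots> = (real k + 2) / 2 ^ k * Q"
      by (simp add: Q_def)
    finally show ?thesis
      by (simp add: Y_def[abs_def] V_def right_diff_distrib sum_subtractf)
  qed
  have chain: "\<bar>V s p\<bar> \<le> X s + (\<Sum>k<K. Y k s)" if "p \<in> P K" for s p K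
    using that
  proof (induction K arbitrary: p)
    case 0
    then show ?case
      using fin by (simp add: X_def)
  next
    case (Suc K)
    have "\<pi> K p \<in> P K"
      using \<pi> sub Suc.prems by blast
    then have "\<bar>V s (\<pi> K p)\<bar> \<le> X s + (\<Sum>k<K. Y k s)"
      by (rule Suc.IH)
    moreover have "\<bar>V s p - V s (\<pi> K p)\<bar> \<le> Y K s"
      using fin Suc.prems by (simp add: Y_def)
    ultimately show ?case
      by simp
  qed
  \<comment> \<open>The 7 is 1 for the coarsest net plus 6 for the sum of the weights. The chain
    stops at level \<open>K\<close>; the remainder \<open>M * \<delta> K\<close> vanishes in the
    limit.\<close>
  have bound: "sign_avg m (\<lambda>s. SUP z\<in>D. \<bar>V s z\<bar>) \<le> 7 * Q + M * \<delta> K" for K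
  proof -
    have "sign_avg m (\<lambda>s. SUP z\<in>D. \<bar>V s z\<bar>) \<le> sign_avg m (\<lambda>s. M * \<delta> K + (X s + (\<Sum>k<K. Y k s)))"
    proof (intro sign_avg_mono cSUP_least D)
      fix s z assume s: "s \<in> signs m" and "z \<in> D"
      then have z: "z \<in> cball 0 r"
        using D by blast
      have "\<bar>V s z\<bar> \<le> \<bar>V s z - V s (\<pi> K z)\<bar> + \<bar>V s (\<pi> K z)\<bar>"
        by simp
      also have "\<bar>V s z - V s (\<pi> K z)\<bar> \<le> M * dist z (\<pi> K z)"
        using s by (rule V_diff)
      also have "\<dots> \<le> M * \<delta> K"
        using \<pi>[OF z] M0 by (intro mult_left_mono)
      also have "\<bar>V s (\<pi> K z)\<bar> \<le> X s + (\<Sum>k<K. Y k s)"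
        by (intro chain \<pi> z)
      finally show "\<bar>V s z\<bar> \<le> M * \<delta> K + (X s + (\<Sum>k<K. Y k s))"
        by simp
    qed
    also have "\<dots> = M * \<delta> K + (sign_avg m X + (\<Sum>k<K. sign_avg m (Y k)))"
      by (simp add: sign_avg_add sign_avg_sum)
    also have "\<dots> \<le> M * \<delta> K + (Q + (\<Sum>k<K. (real k + 2) / 2 ^ k * Q))"
      by (intro add_left_mono add_mono X_avg sum_mono Y_avg)
    also have "(\<Sum>k<K. (real k + 2) / 2 ^ k * Q) = (6 - (2 * real K + 6) / 2 ^ K) * Q"
      unfolding sum_distrib_right[symmetric] sum_chaining_weights ..
    also have "\<dots> \<le> 6 * Q"
      using \<open>0 \<le> Q\<close> by (intro mult_right_mono) auto
    finally show ?thesis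
      by simp
  qed
  have "(\<lambda>K. 7 * Q + M * \<delta> K) \<longlonglongrightarrow> 7 * Q + M * 0"
    unfolding \<delta>_def by (intro tendsto_intros LIMSEQ_divide_realpow_zero) auto
  then have "sign_avg m (\<lambda>s. SUP z\<in>D. \<bar>V s z\<bar>) \<le> 7 * Q + M * 0"
    by (rule LIMSEQ_le_const) (use bound in blast)
  then show ?thesis
    by (simp add: V_def a_def Q_def)
qed

section \<open>McDiarmid's inequality\<close>

text \<open>Fubini with the split-off coordinate in the outer integral: the order in which an
  induction hypothesis about the remaining coordinates applies while that coordinate is
  frozen.\<close>

lemma (in product_sigma_finite) product_integral_insert_rev:
  fixes f :: "_ \<Rightarrow> real"
  assumes I: "finite I" "i \<notin> I" and f: "integrable (Pi\<^sub>M (insert i I) M) f"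
  shows "integral\<^sup>L (Pi\<^sub>M (insert i I) M) f = (\<integral>y. (\<integral>x. f (x(i := y)) \<partial>Pi\<^sub>M I M) \<partial>M i)"
proof -
  interpret I: finite_product_sigma_finite M I
    by standard fact
  have [measurable]: "f \<in> borel_measurable (Pi\<^sub>M (insert i I) M)"
    using f by auto
  have "integral\<^sup>L (Pi\<^sub>M (insert i I) M) f = (\<integral>y. (\<integral>x. f (merge {i} I (y, x)) \<partial>Pi\<^sub>M I M) \<partial>Pi\<^sub>M {i} M)"
    using product_integral_fold[of "{i}" I f] I f by simp
  also have "\<dots> = (\<integral>y. (\<integral>x. f (x(i := y i)) \<partial>Pi\<^sub>M I M) \<partial>Pi\<^sub>M {i} M)"
  proof (intro Bochner_Integration.integral_cong refl arg_cong[where f = f])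
    fix y x assume "x \<in> space (Pi\<^sub>M I M)"
    then show "merge {i} I (y, x) = x(i := y i)"
      using I by (auto simp: merge_def space_PiM PiE_iff extensional_def)
  qed
  also have "\<dots> = (\<integral>y. (\<integral>x. f (x(i := y)) \<partial>Pi\<^sub>M I M) \<partial>M i)"
    by (rule product_integral_singleton) measurable
  finally show ?thesis .
qed

lemma integral_PiM_empty:
  fixes f :: "('i \<Rightarrow> 'a) \<Rightarrow> real"
  shows "integral\<^sup>L (Pi\<^sub>M {} M) f = f (\<lambda>_. undefined)"
  by (simp add: PiM_empty lebesgue_integral_count_space_finite)

text \<open>Hoeffding's lemma without centering: the mean stays visible in the exponent because
  below it is itself a function of the other coordinates.\<close>

lemma (in prob_space) integral_exp_le_Hoeffding:
  fixes f :: "'a \<Rightarrow> real"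
  assumes [measurable]: "f \<in> borel_measurable M" and ab: "\<And>x. x \<in> space M \<Longrightarrow> f x \<in> {a..b}" and "0 < l"
  shows "(\<integral>x. exp (l * f x) \<partial>M) \<le> exp (l * (\<integral>x. f x \<partial>M) + l\<^sup>2 * (b - a)\<^sup>2 / 8)"
proof -
  interpret interval_bounded_random_variable M f a b
    by standard (use ab in auto)
  define \<mu> where "\<mu> = expectation f"
  have "(\<integral>x. exp (l * (f x - \<mu>)) \<partial>M) = enn2real (\<integral>\<^sup>+x. exp (l * (f x - \<mu>)) \<partial>M)"
    by (intro integral_eq_nn_integral) auto
  also have "\<dots> \<le> exp (l\<^sup>2 * (b - a)\<^sup>2 / 8)"
    using Hoeffdings_lemma_nn_integral[OF \<open>0 < l\<close>] by (intro enn2real_leI) (auto simp: \<mu>_def)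
  finally have le: "(\<integral>x. exp (l * (f x - \<mu>)) \<partial>M) \<le> exp (l\<^sup>2 * (b - a)\<^sup>2 / 8)" .
  have "(\<integral>x. exp (l * f x) \<partial>M) = (\<integral>x. exp (l * \<mu>) * exp (l * (f x - \<mu>)) \<partial>M)"
    by (intro Bochner_Integration.integral_cong refl) (simp add: exp_add[symmetric] right_diff_distrib)
  also have "\<dots> = exp (l * \<mu>) * (\<integral>x. exp (l * (f x - \<mu>)) \<partial>M)"
    by (rule integral_mult_right_zero)
  also have "\<dots> \<le> exp (l * \<mu>) * exp (l\<^sup>2 * (b - a)\<^sup>2 / 8)"
    using le by (intro mult_left_mono) auto
  finally show ?thesis
    by (simp only: \<mu>_def exp_add)
qed

text \<open>Integrating out the last coordinate leaves a function \<open>g\<close> with the same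
  bounded differences, at the price of one factor \<open>exp (l\<^sup>2 * c\<^sup>2 / 8)\<close>.
  The induction thus plays the part of the martingale of conditional expectations.\<close>

lemma (in prob_space) bounded_differences_mgf:
  fixes f :: "(nat \<Rightarrow> 'a) \<Rightarrow> real"
  assumes "f \<in> borel_measurable (Pi\<^sub>M {..<n} (\<lambda>_. M))"
    and "\<And>x. x \<in> space (Pi\<^sub>M {..<n} (\<lambda>_. M)) \<Longrightarrow> \<bar>f x\<bar> \<le> B"
    and "\<And>x j y. x \<in> space (Pi\<^sub>M {..<n} (\<lambda>_. M)) \<Longrightarrow> j < n \<Longrightarrow> y \<in> space M \<Longrightarrow> \<bar>f (x(j := y)) - f x\<bar> \<le> c"
    and "0 < l"
  shows "(\<integral>x. exp (l * f x) \<partial>Pi\<^sub>M {..<n} (\<lambda>_. M))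
      \<le> exp (l * (\<integral>x. f x \<partial>Pi\<^sub>M {..<n} (\<lambda>_. M)) + real n * (l\<^sup>2 * c\<^sup>2 / 8))"
  using assms(1-3)
proof (induction n arbitrary: f)
  case 0
  show ?case
    by (simp add: integral_PiM_empty)
next
  case (Suc n)
  interpret PP: product_prob_space "\<lambda>_::nat. M"
    by unfold_locales
  let ?P = "\<lambda>n::nat. Pi\<^sub>M {..<n} (\<lambda>_. M)"
  interpret Pn: prob_space "?P n" by (intro prob_space_PiM prob_space_axioms)
  interpret PS: prob_space "?P (Suc n)" by (intro prob_space_PiM prob_space_axioms)
  have eq: "{..<Suc n} = insert n {..<n}"
    by (rule lessThan_Suc)
  note [measurable] = Suc.prems(1)[unfolded eq]
  have upd: "x(n := y) \<in> space (?P (Suc n))" if "x \<in> space (?P n)" "y \<in> space M" for x y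
    using that by (auto simp: space_PiM eq intro!: PiE_fun_upd)
  define g where "g x = (\<integral>y. f (x(n := y)) \<partial>M)" for x
  have f_int: "integrable (?P (Suc n)) f"
    using Suc.prems by (intro PS.integrable_const_bound[where B = B] AE_I2) auto
  have expf_int: "integrable (?P (Suc n)) (\<lambda>x. exp (l * f x))"
    using Suc.prems \<open>0 < l\<close> by (intro PS.integrable_const_bound[where B = "exp (l * B)"] AE_I2) (auto simp: abs_le_iff)
  have fx_int: "integrable M (\<lambda>y. f (x(n := y)))" if [measurable]: "x \<in> space (?P n)" for x
    using Suc.prems(1,2) upd[OF that]
    by (intro integrable_const_bound[where B = B] AE_I2) auto
  have g_meas: "g \<in> borel_measurable (?P n)"
    unfolding g_def by measurable
  have g_bound: "\<bar>g x\<bar> \<le> B" if "x \<in> space (?P n)" for x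
  proof -
    have "\<bar>g x\<bar> \<le> (\<integral>y. B \<partial>M)"
      unfolding g_def using fx_int[OF that] Suc.prems(2) upd[OF that]
      by (intro order_trans[OF integral_abs_bound] integral_mono) auto
    then show ?thesis
      by (simp add: prob_space)
  qed
  have g_diff: "\<bar>g (x(j := y)) - g x\<bar> \<le> c" if x: "x \<in> space (?P n)" and "j < n" "y \<in> space M" for x j y
  proof -
    have x': "x(j := y) \<in> space (?P n)"
      using that by (auto simp: space_PiM PiE_iff extensional_def)
    have "g (x(j := y)) - g x = (\<integral>z. f (x(j := y, n := z)) - f (x(n := z)) \<partial>M)"
      unfolding g_def using fx_int[OF x] fx_int[OF x'] by simp
    also have "\<bar>\<dots>\<bar> \<le> (\<integral>z. c \<partial>M)"
    proof (intro order_trans[OF integral_abs_bound] integral_mono)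
      fix z assume "z \<in> space M"
      then show "\<bar>f (x(j := y, n := z)) - f (x(n := z))\<bar> \<le> c"
        using \<open>j < n\<close> \<open>y \<in> space M\<close>
        by (subst fun_upd_twist) (auto intro: Suc.prems(3) upd[OF x])
    qed (use fx_int[OF x] fx_int[OF x'] in auto)
    finally show ?thesis
      by (simp add: prob_space)
  qed
  have inner: "(\<integral>y. exp (l * f (x(n := y))) \<partial>M) \<le> exp (l * g x) * exp (l\<^sup>2 * c\<^sup>2 / 8)" if x: "x \<in> space (?P n)" for x
  proof -
    \<comment> \<open>With the other coordinates frozen, any two values differ by at most
      \<open>c\<close>, so all lie in an interval of length \<open>c\<close> starting at their
      infimum. An interval centered at one of the values would have length \<open>2 * c\<close> and
      lose a factor 4 in the exponent.\<close>
    define a where "a = (INF y\<in>space M. f (x(n := y)))"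
    have ge: "f (x(n := y)) - c \<le> f (x(n := y'))" if "y \<in> space M" "y' \<in> space M" for y y'
      using Suc.prems(3)[OF upd[OF x that(1)] lessI that(2)] by (simp only: fun_upd_upd abs_le_iff) linarith
    have bdd: "bdd_below ((\<lambda>y. f (x(n := y))) ` space M)"
    proof (rule bdd_belowI2[where m = "- B"])
      fix y assume "y \<in> space M"
      then have "\<bar>f (x(n := y))\<bar> \<le> B"
        by (intro Suc.prems upd x)
      then show "- B \<le> f (x(n := y))"
        by linarith
    qed
    have "(\<integral>y. exp (l * f (x(n := y))) \<partial>M) \<le> exp (l * g x + l\<^sup>2 * ((a + c) - a)\<^sup>2 / 8)"
      unfolding g_def
    proof (rule integral_exp_le_Hoeffding)
      fix y assume y: "y \<in> space M"
      have "f (x(n := y)) - c \<le> a"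
        unfolding a_def using not_empty ge y by (intro cINF_greatest) auto
      moreover have "a \<le> f (x(n := y))"
        unfolding a_def by (rule cINF_lower[OF bdd y])
      ultimately show "f (x(n := y)) \<in> {a..a + c}"
        by auto
    qed (use fx_int[OF x] \<open>0 < l\<close> in auto)
    then show ?thesis
      by (simp add: exp_add)
  qed
  have "(\<integral>x. exp (l * f x) \<partial>?P (Suc n)) = (\<integral>x. (\<integral>y. exp (l * f (x(n := y))) \<partial>M) \<partial>?P n)"
    using expf_int unfolding eq by (intro PP.product_integral_insert) auto
  also have "\<dots> \<le> (\<integral>x. exp (l * g x) * exp (l\<^sup>2 * c\<^sup>2 / 8) \<partial>?P n)"
  proof (intro integral_mono' inner)
    show "integrable (?P n) (\<lambda>x. exp (l * g x) * exp (l\<^sup>2 * c\<^sup>2 / 8))"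
      using g_meas g_bound \<open>0 < l\<close>
      by (intro integrable_mult_left Pn.integrable_const_bound[where B = "exp (l * B)"] AE_I2) (auto simp: abs_le_iff)
  qed auto
  also have "\<dots> = (\<integral>x. exp (l * g x) \<partial>?P n) * exp (l\<^sup>2 * c\<^sup>2 / 8)"
    by simp
  also have "\<dots> \<le> exp (l * (\<integral>x. g x \<partial>?P n) + real n * (l\<^sup>2 * c\<^sup>2 / 8)) * exp (l\<^sup>2 * c\<^sup>2 / 8)"
    by (intro mult_right_mono Suc.IH g_meas g_bound g_diff) auto
  also have "(\<integral>x. g x \<partial>?P n) = (\<integral>x. f x \<partial>?P (Suc n))"
    unfolding g_def using f_int unfolding eq by (intro PP.product_integral_insert[symmetric]) auto
  finally show ?case
    by (simp add: exp_add[symmetric] distrib_right add_divide_distrib add_ac)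
qed

lemma (in prob_space) McDiarmid_ineq_ge:
  fixes f :: "(nat \<Rightarrow> 'a) \<Rightarrow> real"
  assumes f: "f \<in> borel_measurable (Pi\<^sub>M {..<n} (\<lambda>_. M))"
    and B: "\<And>x. x \<in> space (Pi\<^sub>M {..<n} (\<lambda>_. M)) \<Longrightarrow> \<bar>f x\<bar> \<le> B"
    and c: "\<And>x j y. x \<in> space (Pi\<^sub>M {..<n} (\<lambda>_. M)) \<Longrightarrow> j < n \<Longrightarrow> y \<in> space M \<Longrightarrow> \<bar>f (x(j := y)) - f x\<bar> \<le> c"
    and pos: "0 < n" "0 < c" "0 < t"
  shows "measure (Pi\<^sub>M {..<n} (\<lambda>_. M)) {x \<in> space (Pi\<^sub>M {..<n} (\<lambda>_. M)).
      (\<integral>x. f x \<partial>Pi\<^sub>M {..<n} (\<lambda>_. M)) + t \<le> f x} \<le> exp (- (2 * t\<^sup>2 / (real n * c\<^sup>2)))"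
proof -
  let ?P = "Pi\<^sub>M {..<n} (\<lambda>_. M)"
  interpret P: prob_space ?P by (intro prob_space_PiM prob_space_axioms)
  define \<mu> where "\<mu> = (\<integral>x. f x \<partial>?P)"
  \<comment> \<open>Chernoff's method: this \<open>l\<close> minimizes
    \<open>real n * (l\<^sup>2 * c\<^sup>2 / 8) - l * t\<close>.\<close>
  define l where "l = 4 * t / (real n * c\<^sup>2)"
  have "0 < l"
    using pos by (simp add: l_def)
  have int: "integrable ?P (\<lambda>x. exp (l * f x))"
    using f B \<open>0 < l\<close> by (intro P.integrable_const_bound[where B = "exp (l * B)"] AE_I2) (auto simp: abs_le_iff)
  have "{x \<in> space ?P. \<mu> + t \<le> f x} = {x \<in> space ?P. exp (l * (\<mu> + t)) \<le> exp (l * f x)}"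
    using \<open>0 < l\<close> by simp
  also have "measure ?P \<dots> \<le> (\<integral>x. exp (l * f x) \<partial>?P) / exp (l * (\<mu> + t))"
    by (rule integral_Markov_inequality_measure[OF int]) auto
  also have "\<dots> \<le> exp (l * \<mu> + real n * (l\<^sup>2 * c\<^sup>2 / 8)) / exp (l * (\<mu> + t))"
    unfolding \<mu>_def using bounded_differences_mgf[OF f B c \<open>0 < l\<close>] by (intro divide_right_mono) auto
  also have "\<dots> = exp (real n * (l\<^sup>2 * c\<^sup>2 / 8) - l * t)"
    by (simp add: exp_diff[symmetric] distrib_left)
  also have "real n * (l\<^sup>2 * c\<^sup>2 / 8) - l * t = - (2 * t\<^sup>2 / (real n * c\<^sup>2))"
    using pos by (simp add: l_def power2_eq_square divide_simps)
  finally show ?thesis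
    by (simp add: \<mu>_def)
qed

section \<open>Symmetrization\<close>

text \<open>A real supremum is informative only for a bounded family, hence the explicit uniform
  bounds that accompany the suprema below.\<close>

lemma SUP_abs_le:
  fixes g :: "'i \<Rightarrow> real"
  assumes "Z \<noteq> {}" "\<And>z. z \<in> Z \<Longrightarrow> \<bar>g z\<bar> \<le> A"
  shows "\<bar>SUP z\<in>Z. \<bar>g z\<bar>\<bar> \<le> A"
proof -
  obtain z where "z \<in> Z"
    using assms by blast
  then have "\<bar>g z\<bar> \<le> (SUP z\<in>Z. \<bar>g z\<bar>)"
    using assms by (intro cSUP_upper) (auto intro!: bdd_aboveI2[where M = A])
  moreover have "(SUP z\<in>Z. \<bar>g z\<bar>) \<le> A"
    using assms by (intro cSUP_least) auto
  ultimately show ?thesis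
    by simp
qed

lemma borel_measurable_SUP_abs:
  fixes g :: "'i \<Rightarrow> 'a \<Rightarrow> real"
  assumes "countable Z" and "\<And>z. z \<in> Z \<Longrightarrow> g z \<in> borel_measurable N"
    and "\<And>z x. z \<in> Z \<Longrightarrow> x \<in> space N \<Longrightarrow> \<bar>g z x\<bar> \<le> A"
  shows "(\<lambda>x. SUP z\<in>Z. \<bar>g z x\<bar>) \<in> borel_measurable N"
  using assms by (intro borel_measurable_cSUP) (auto intro!: bdd_aboveI2[where M = A])

lemma (in finite_measure) integrable_SUP_abs:
  fixes g :: "'i \<Rightarrow> 'a \<Rightarrow> real"
  assumes "countable Z" "Z \<noteq> {}" and "\<And>z. z \<in> Z \<Longrightarrow> g z \<in> borel_measurable M"
    and "\<And>z x. z \<in> Z \<Longrightarrow> x \<in> space M \<Longrightarrow> \<bar>g z x\<bar> \<le> A"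
  shows "integrable M (\<lambda>x. SUP z\<in>Z. \<bar>g z x\<bar>)"
proof (rule integrable_const_bound[where B = A])
  show "AE x in M. norm (SUP z\<in>Z. \<bar>g z x\<bar>) \<le> A"
    using assms by (intro AE_I2) (auto intro: SUP_abs_le)
  show "(\<lambda>x. SUP z\<in>Z. \<bar>g z x\<bar>) \<in> borel_measurable M"
    using assms(1,3,4) by (rule borel_measurable_SUP_abs)
qed

lemma integral_sign_avg:
  assumes "\<And>s. s \<in> signs m \<Longrightarrow> integrable M (\<lambda>x. F s x)"
  shows "(\<integral>x. sign_avg m (\<lambda>s. F s x) \<partial>M) = sign_avg m (\<lambda>s. \<integral>x. F s x \<partial>M)"
  using assms by (simp add: sign_avg_def)

lemma integrable_sign_avg:
  assumes "\<And>s. s \<in> signs m \<Longrightarrow> integrable M (\<lambda>x. F s x)"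
  shows "integrable M (\<lambda>x. sign_avg m (\<lambda>s. F s x))"
  using assms by (simp add: sign_avg_def)

text \<open>With an independent copy \<open>y'\<close> of \<open>y\<close>, the term
  \<open>c + f y - f y'\<close> is the mean of \<open>c + 2 * f y\<close> and \<open>c - 2 * f y'\<close>.\<close>

lemma (in prob_space) symmetrization_single:
  fixes f :: "'i \<Rightarrow> 'a \<Rightarrow> real"
  assumes Z: "countable Z" "Z \<noteq> {}"
    and f [measurable]: "\<And>z. z \<in> Z \<Longrightarrow> f z \<in> borel_measurable M"
    and B: "\<And>z x. z \<in> Z \<Longrightarrow> x \<in> space M \<Longrightarrow> \<bar>f z x\<bar> \<le> B"
    and A: "\<And>z. z \<in> Z \<Longrightarrow> \<bar>c z\<bar> \<le> A"
  shows "(\<integral>y. (SUP z\<in>Z. \<bar>c z + (f z y - expectation (f z))\<bar>) \<partial>M)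
      \<le> ((\<integral>y. (SUP z\<in>Z. \<bar>c z + 2 * f z y\<bar>) \<partial>M) + (\<integral>y. (SUP z\<in>Z. \<bar>c z - 2 * f z y\<bar>) \<partial>M)) / 2"
proof -
  define P where "P y = (SUP z\<in>Z. \<bar>c z + 2 * f z y\<bar>)" for y
  define N where "N y = (SUP z\<in>Z. \<bar>c z - 2 * f z y\<bar>)" for y
  have bP: "\<bar>c z + 2 * f z y\<bar> \<le> A + 2 * B" "\<bar>c z - 2 * f z y\<bar> \<le> A + 2 * B" if "z \<in> Z" "y \<in> space M" for z y
    using A[OF that(1)] B[OF that] by linarith+
  have f_int: "integrable M (f z)" if "z \<in> Z" for z
    using that B by (intro integrable_const_bound[where B = B] AE_I2) auto
  have P_int: "integrable M P" and N_int: "integrable M N"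
    unfolding P_def N_def using Z bP by (intro integrable_SUP_abs[where A = "A + 2 * B"]; simp)+
  have P_ge: "\<bar>c z + 2 * f z y\<bar> \<le> P y" and N_ge: "\<bar>c z - 2 * f z y\<bar> \<le> N y" if "z \<in> Z" "y \<in> space M" for z y
    unfolding P_def N_def using that bP
    by (auto intro!: cSUP_upper bdd_aboveI2[where M = "A + 2 * B"])
  have "(SUP z\<in>Z. \<bar>c z + (f z y - expectation (f z))\<bar>) \<le> (P y + expectation N) / 2" if y: "y \<in> space M" for y
  proof (intro cSUP_least Z)
    fix z assume z: "z \<in> Z"
    have "c z + (f z y - expectation (f z)) = (\<integral>y'. c z + (f z y - f z y') \<partial>M)"
      using f_int[OF z] by (simp add: prob_space)
    also have "\<bar>\<dots>\<bar> \<le> (\<integral>y'. (P y + N y') / 2 \<partial>M)"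
    proof (intro order_trans[OF integral_abs_bound] integral_mono)
      fix y' assume "y' \<in> space M"
      then show "\<bar>c z + (f z y - f z y')\<bar> \<le> (P y + N y') / 2"
        using P_ge[OF z y, THEN abs_le_D1] P_ge[OF z y, THEN abs_le_D2]
          N_ge[OF z, of y', THEN abs_le_D1] N_ge[OF z, of y', THEN abs_le_D2]
        by (intro abs_leI) (auto simp: field_simps)
    qed (use f_int[OF z] N_int in auto)
    also have "\<dots> = (P y + expectation N) / 2"
      using N_int by (simp add: prob_space)
    finally show "\<bar>c z + (f z y - expectation (f z))\<bar> \<le> (P y + expectation N) / 2" .
  qed
  then have "(\<integral>y. (SUP z\<in>Z. \<bar>c z + (f z y - expectation (f z))\<bar>) \<partial>M) \<le> (\<integral>y. (P y + expectation N) / 2 \<partial>M)"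
  proof (intro integral_mono)
    show "integrable M (\<lambda>y. SUP z\<in>Z. \<bar>c z + (f z y - expectation (f z))\<bar>)"
    proof (rule integrable_SUP_abs[where A = "A + 2 * B"])
      fix z y assume "z \<in> Z" "y \<in> space M"
      moreover have "\<bar>expectation (f z)\<bar> \<le> (\<integral>y. B \<partial>M)" if "z \<in> Z"
        using f_int[OF that] B[OF that] by (intro order_trans[OF integral_abs_bound] integral_mono) auto
      ultimately show "\<bar>c z + (f z y - expectation (f z))\<bar> \<le> A + 2 * B"
        using A[of z] B[of z y] by (simp add: prob_space)
    qed (use Z in auto)
  qed (use P_int in auto)
  also have "\<dots> = (expectation P + expectation N) / 2"
    using P_int by (simp add: prob_space)
  finally show ?thesis
    by (simp add: P_def[abs_def] N_def[abs_def])
qed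

text \<open>Boundedness by \<open>K\<close> settles together all integrability conditions that arise
  when the last coordinate is split off, in either order of integration.\<close>

lemma (in prob_space) integrable_PiM_Suc_slices:
  fixes F :: "(nat \<Rightarrow> 'a) \<Rightarrow> real"
  assumes [measurable]: "F \<in> borel_measurable (Pi\<^sub>M {..<Suc n} (\<lambda>_. M))"
    and K: "\<And>x. x \<in> space (Pi\<^sub>M {..<Suc n} (\<lambda>_. M)) \<Longrightarrow> \<bar>F x\<bar> \<le> K"
  shows "integrable (Pi\<^sub>M {..<Suc n} (\<lambda>_. M)) F"
    and "y \<in> space M \<Longrightarrow> integrable (Pi\<^sub>M {..<n} (\<lambda>_. M)) (\<lambda>x. F (x(n := y)))"
    and "x \<in> space (Pi\<^sub>M {..<n} (\<lambda>_. M)) \<Longrightarrow> integrable M (\<lambda>y. F (x(n := y)))"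
    and "integrable M (\<lambda>y. \<integral>x. F (x(n := y)) \<partial>Pi\<^sub>M {..<n} (\<lambda>_. M))"
    and "integrable (Pi\<^sub>M {..<n} (\<lambda>_. M)) (\<lambda>x. \<integral>y. F (x(n := y)) \<partial>M)"
proof -
  let ?P = "\<lambda>n::nat. Pi\<^sub>M {..<n} (\<lambda>_. M)"
  interpret Pn: prob_space "?P n" by (intro prob_space_PiM prob_space_axioms)
  interpret PS: prob_space "?P (Suc n)" by (intro prob_space_PiM prob_space_axioms)
  have [measurable]: "(\<lambda>(x, y). x(n := y)) \<in> measurable (?P n \<Otimes>\<^sub>M M) (?P (Suc n))"
    unfolding lessThan_Suc by (rule measurable_add_dim)
  have upd: "x(n := y) \<in> space (?P (Suc n))" if "x \<in> space (?P n)" "y \<in> space M" for x y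
    using that unfolding lessThan_Suc by (auto simp: space_PiM intro!: PiE_fun_upd)
  show "integrable (?P (Suc n)) F"
    using K by (intro PS.integrable_const_bound[where B = K] AE_I2) auto
  have int1: "integrable (?P n) (\<lambda>x. F (x(n := y)))" if [measurable]: "y \<in> space M" for y
  proof (intro Pn.integrable_const_bound[where B = K] AE_I2)
    have "(\<lambda>x. F (case (x, y) of (x, y) \<Rightarrow> x(n := y))) \<in> borel_measurable (?P n)"
      by measurable
    then show "(\<lambda>x. F (x(n := y))) \<in> borel_measurable (?P n)"
      by simp
  qed (use K upd that in auto)
  have int2: "integrable M (\<lambda>y. F (x(n := y)))" if [measurable]: "x \<in> space (?P n)" for x
  proof (intro integrable_const_bound[where B = K] AE_I2)
    have "(\<lambda>y. F (case (x, y) of (x, y) \<Rightarrow> x(n := y))) \<in> borel_measurable M"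
      by measurable
    then show "(\<lambda>y. F (x(n := y))) \<in> borel_measurable M"
      by simp
  qed (use K upd that in auto)
  show "y \<in> space M \<Longrightarrow> integrable (?P n) (\<lambda>x. F (x(n := y)))"
    and "x \<in> space (?P n) \<Longrightarrow> integrable M (\<lambda>y. F (x(n := y)))"
    by (fact int1 int2)+
  show "integrable M (\<lambda>y. \<integral>x. F (x(n := y)) \<partial>?P n)"
  proof (intro integrable_const_bound[where B = K] AE_I2)
    have "(\<lambda>y. \<integral>x. F (case (x, y) of (x, y) \<Rightarrow> x(n := y)) \<partial>?P n) \<in> borel_measurable M"
      by measurable
    then show "(\<lambda>y. \<integral>x. F (x(n := y)) \<partial>?P n) \<in> borel_measurable M"
      by simp
    fix y assume "y \<in> space M"
    then have "\<bar>\<integral>x. F (x(n := y)) \<partial>?P n\<bar> \<le> (\<integral>x. K \<partial>?P n)"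
      using int1 K upd by (intro order_trans[OF integral_abs_bound] integral_mono) auto
    then show "norm (\<integral>x. F (x(n := y)) \<partial>?P n) \<le> K"
      by (simp add: Pn.prob_space)
  qed
  show "integrable (?P n) (\<lambda>x. \<integral>y. F (x(n := y)) \<partial>M)"
  proof (intro Pn.integrable_const_bound[where B = K] AE_I2)
    have "(\<lambda>x. \<integral>y. F (case (x, y) of (x, y) \<Rightarrow> x(n := y)) \<partial>M) \<in> borel_measurable (?P n)"
      by measurable
    then show "(\<lambda>x. \<integral>y. F (x(n := y)) \<partial>M) \<in> borel_measurable (?P n)"
      by simp
    fix x assume "x \<in> space (?P n)"
    then have "\<bar>\<integral>y. F (x(n := y)) \<partial>M\<bar> \<le> (\<integral>y. K \<partial>M)"
      using int2 K upd by (intro order_trans[OF integral_abs_bound] integral_mono) auto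
    then show "norm (\<integral>y. F (x(n := y)) \<partial>M) \<le> K"
      by (simp add: prob_space)
  qed
qed

text \<open>The independent copy is introduced one coordinate at a time, so no second product space
  is formed. The offset \<open>c\<close> is there for the induction: the term already symmetrized
  moves into it before the hypothesis is applied to the others.\<close>

lemma (in prob_space) symmetrization:
  fixes f :: "'i \<Rightarrow> 'a \<Rightarrow> real"
  assumes Z: "countable Z" "Z \<noteq> {}"
    and f: "\<And>z. z \<in> Z \<Longrightarrow> f z \<in> borel_measurable M"
    and B: "\<And>z x. z \<in> Z \<Longrightarrow> x \<in> space M \<Longrightarrow> \<bar>f z x\<bar> \<le> B"
    and A: "\<And>z. z \<in> Z \<Longrightarrow> \<bar>c z\<bar> \<le> A"
  shows "(\<integral>x. (SUP z\<in>Z. \<bar>c z + (\<Sum>j<n. f z (x j) - expectation (f z))\<bar>) \<partial>Pi\<^sub>M {..<n} (\<lambda>_. M))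
      \<le> sign_avg n (\<lambda>s. \<integral>x. (SUP z\<in>Z. \<bar>c z + 2 * (\<Sum>j<n. s j * f z (x j))\<bar>) \<partial>Pi\<^sub>M {..<n} (\<lambda>_. M))"
  using A
proof (induction n arbitrary: c A)
  case 0
  show ?case
    by (simp add: integral_PiM_empty sign_avg_def signs_def)
next
  case (Suc n)
  interpret PP: product_prob_space "\<lambda>_::nat. M"
    by unfold_locales
  let ?P = "\<lambda>n::nat. Pi\<^sub>M {..<n} (\<lambda>_. M)"
  interpret Pn: prob_space "?P n" by (intro prob_space_PiM prob_space_axioms)
  interpret PS: prob_space "?P (Suc n)" by (intro prob_space_PiM prob_space_axioms)
  have eq: "{..<Suc n} = insert n {..<n}"
    by (rule lessThan_Suc)
  let ?E = "\<lambda>z. expectation (f z)"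
  let ?S = "\<lambda>s x z. \<Sum>j<n. s j * f z (x j)"
  let ?D = "\<lambda>x z. \<Sum>j<n. f z (x j) - ?E z"
  have E: "\<bar>?E z\<bar> \<le> B" if "z \<in> Z" for z
  proof -
    have "integrable M (f z)"
      using f B that by (intro integrable_const_bound[where B = B] AE_I2) auto
    then have "\<bar>?E z\<bar> \<le> (\<integral>y. B \<partial>M)"
      using B[OF that] by (intro order_trans[OF integral_abs_bound] integral_mono) auto
    then show ?thesis
      by (simp add: prob_space)
  qed
  have sp: "x j \<in> space M" if "x \<in> space (?P k)" "j < k" for x j k
    using that by (auto simp: space_PiM PiE_iff)
  have S_le: "\<bar>?S s x z\<bar> \<le> real n * B" if "s \<in> signs n" "x \<in> space (?P n)" "z \<in> Z" for s x z
  proof -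
    have "\<bar>?S s x z\<bar> \<le> (\<Sum>j<n. \<bar>s j * f z (x j)\<bar>)"
      by (rule sum_abs)
    also have "\<dots> \<le> (\<Sum>j<n. B)"
      using that B[OF that(3) sp[OF that(2)]] by (intro sum_mono) (auto simp: abs_mult signs_abs)
    finally show ?thesis
      by simp
  qed
  have D_le: "\<bar>?D x z\<bar> \<le> real n * (2 * B)" if "x \<in> space (?P n)" "z \<in> Z" for x z
  proof -
    have "\<bar>?D x z\<bar> \<le> (\<Sum>j<n. \<bar>f z (x j) - ?E z\<bar>)"
      by (rule sum_abs)
    also have "\<dots> \<le> (\<Sum>j<n. 2 * B)"
    proof (rule sum_mono)
      fix j assume "j \<in> {..<n}"
      then show "\<bar>f z (x j) - ?E z\<bar> \<le> 2 * B"
        using B[OF that(2) sp[OF that(1), of j]] E[OF that(2)] by simp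
    qed
    finally show ?thesis
      by simp
  qed
  \<comment> \<open>Sums over the first \<open>n\<close> coordinates do not see coordinate
    \<open>n\<close>, so their bounds carry over to the longer product by restriction.\<close>
  have restr: "x \<in> space (?P (Suc n)) \<Longrightarrow> (\<lambda>j\<in>{..<n}. x j) \<in> space (?P n)" for x
    by (auto simp: space_PiM PiE_iff)
  have D_le': "\<bar>?D x z\<bar> \<le> real n * (2 * B)" and S_le': "s \<in> signs n \<Longrightarrow> \<bar>?S s x z\<bar> \<le> real n * B"
    if "x \<in> space (?P (Suc n))" "z \<in> Z" for x z s
    using D_le[OF restr[OF that(1)] that(2)] S_le[OF _ restr[OF that(1)] that(2)] by simp_all
  have f_comp: "(\<lambda>x. f z (x j)) \<in> borel_measurable (?P k)" if "z \<in> Z" "j < k" for z j k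
    using that by (intro measurable_compose[OF _ f]) (auto intro: measurable_component_singleton)
  have upd: "x(n := y) \<in> space (?P (Suc n))" if "x \<in> space (?P n)" "y \<in> space M" for x y
    using that by (auto simp: space_PiM eq intro!: PiE_fun_upd)

  \<comment> \<open>\<open>H\<close> interpolates between \<open>F\<close>, where every term is
    centered, and \<open>G\<close>, where every term is symmetrized: it has only the last term
    symmetrized, with the sign \<open>\<epsilon>\<close>.\<close>
  define H where "H \<epsilon> x = (SUP z\<in>Z. \<bar>c z + 2 * \<epsilon> * f z (x n) + ?D x z\<bar>)" for \<epsilon> :: real and x
  define G where "G \<epsilon> s x = (SUP z\<in>Z. \<bar>c z + 2 * \<epsilon> * f z (x n) + 2 * ?S s x z\<bar>)" for \<epsilon> :: real and s x
  define F where "F x = (SUP z\<in>Z. \<bar>c z + (\<Sum>j<Suc n. f z (x j) - ?E z)\<bar>)" for x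
  have H_upd: "H \<epsilon> (x(n := y)) = (SUP z\<in>Z. \<bar>c z + 2 * \<epsilon> * f z y + ?D x z\<bar>)" for \<epsilon> x y
    by (simp add: H_def)
  have G_upd: "G \<epsilon> s (x(n := y)) = (SUP z\<in>Z. \<bar>c z + 2 * \<epsilon> * f z y + 2 * ?S s x z\<bar>)" for \<epsilon> s x y
    by (simp add: G_def)
  have c': "\<bar>c z + 2 * \<epsilon> * f z y\<bar> \<le> A + 2 * B" if "\<bar>\<epsilon>\<bar> = 1" "z \<in> Z" "y \<in> space M" for \<epsilon> z y
  proof -
    have "\<bar>c z + 2 * \<epsilon> * f z y\<bar> \<le> \<bar>c z\<bar> + 2 * \<bar>f z y\<bar>"
      using abs_triangle_ineq[of "c z" "2 * \<epsilon> * f z y"] that(1) by (simp add: abs_mult)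
    then show ?thesis
      using Suc.prems[OF that(2)] B[OF that(2,3)] by simp
  qed
  note meas_intros = borel_measurable_add borel_measurable_times borel_measurable_sum borel_measurable_diff
      borel_measurable_const f_comp
  have H: "H \<epsilon> \<in> borel_measurable (?P (Suc n))"
      "\<And>x. x \<in> space (?P (Suc n)) \<Longrightarrow> \<bar>H \<epsilon> x\<bar> \<le> (A + 2 * B) + real n * (2 * B)"
    if \<epsilon>: "\<bar>\<epsilon>\<bar> = 1" for \<epsilon>
  proof -
    have le: "\<bar>c z + 2 * \<epsilon> * f z (x n) + ?D x z\<bar> \<le> (A + 2 * B) + real n * (2 * B)"
      if "z \<in> Z" "x \<in> space (?P (Suc n))" for z x
      using that \<epsilon> by (intro order_trans[OF abs_triangle_ineq] add_mono c' D_le' sp) auto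
    then show "\<And>x. x \<in> space (?P (Suc n)) \<Longrightarrow> \<bar>H \<epsilon> x\<bar> \<le> (A + 2 * B) + real n * (2 * B)"
      unfolding H_def using Z by (intro SUP_abs_le)
    show "H \<epsilon> \<in> borel_measurable (?P (Suc n))"
      unfolding H_def[abs_def] using le by (intro borel_measurable_SUP_abs[OF Z(1)] meas_intros) auto
  qed
  have G: "G \<epsilon> s \<in> borel_measurable (?P (Suc n))"
      "\<And>x. x \<in> space (?P (Suc n)) \<Longrightarrow> \<bar>G \<epsilon> s x\<bar> \<le> (A + 2 * B) + 2 * (real n * B)"
    if \<epsilon>: "\<bar>\<epsilon>\<bar> = 1" and s: "s \<in> signs n" for \<epsilon> s
  proof -
    have le: "\<bar>c z + 2 * \<epsilon> * f z (x n) + 2 * ?S s x z\<bar> \<le> (A + 2 * B) + 2 * (real n * B)"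
      if *: "z \<in> Z" "x \<in> space (?P (Suc n))" for z x
    proof -
      have "\<bar>2 * ?S s x z\<bar> \<le> 2 * (real n * B)"
        using S_le'[OF *(2,1) s] by (simp add: abs_mult)
      with * \<epsilon> show ?thesis
        by (intro order_trans[OF abs_triangle_ineq] add_mono c' sp) auto
    qed
    then show "\<And>x. x \<in> space (?P (Suc n)) \<Longrightarrow> \<bar>G \<epsilon> s x\<bar> \<le> (A + 2 * B) + 2 * (real n * B)"
      unfolding G_def using Z by (intro SUP_abs_le)
    show "G \<epsilon> s \<in> borel_measurable (?P (Suc n))"
      unfolding G_def[abs_def] using le by (intro borel_measurable_SUP_abs[OF Z(1)] meas_intros) auto
  qed
  have F: "F \<in> borel_measurable (?P (Suc n))"
      "\<And>x. x \<in> space (?P (Suc n)) \<Longrightarrow> \<bar>F x\<bar> \<le> A + (real n * (2 * B) + 2 * B)"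
  proof -
    have le: "\<bar>c z + (\<Sum>j<Suc n. f z (x j) - ?E z)\<bar> \<le> A + (real n * (2 * B) + 2 * B)"
      if *: "z \<in> Z" "x \<in> space (?P (Suc n))" for z x
    proof -
      have "\<bar>f z (x n) - ?E z\<bar> \<le> 2 * B"
        using B[OF *(1) sp[OF *(2), of n]] E[OF *(1)] by simp
      then show ?thesis
        unfolding sum.lessThan_Suc
        using * Suc.prems by (intro order_trans[OF abs_triangle_ineq] add_mono order_trans[OF abs_triangle_ineq] D_le') auto
    qed
    then show "\<And>x. x \<in> space (?P (Suc n)) \<Longrightarrow> \<bar>F x\<bar> \<le> A + (real n * (2 * B) + 2 * B)"
      unfolding F_def using Z by (intro SUP_abs_le)
    show "F \<in> borel_measurable (?P (Suc n))"
      unfolding F_def[abs_def] using le by (intro borel_measurable_SUP_abs[OF Z(1)] meas_intros) auto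
  qed
  note slice = integrable_PiM_Suc_slices

  \<comment> \<open>For a frozen last coordinate \<open>y\<close> the new offset is
    \<open>c z + 2 * \<epsilon> * f z y\<close>, bounded by \<open>A + 2 * B\<close>; this is why
    the induction generalizes over \<open>A\<close> as well as \<open>c\<close>.\<close>
  have half: "(\<integral>x. H \<epsilon> x \<partial>?P (Suc n)) \<le> sign_avg n (\<lambda>s. \<integral>x. G \<epsilon> s x \<partial>?P (Suc n))"
    if \<epsilon>: "\<bar>\<epsilon>\<bar> = 1" for \<epsilon> :: real
  proof -
    have "(\<integral>x. H \<epsilon> x \<partial>?P (Suc n)) = (\<integral>y. (\<integral>x. H \<epsilon> (x(n := y)) \<partial>?P n) \<partial>M)"
      using slice(1)[OF H[OF \<epsilon>]] unfolding eq by (intro PP.product_integral_insert_rev) auto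
    also have "\<dots> \<le> (\<integral>y. sign_avg n (\<lambda>s. \<integral>x. G \<epsilon> s (x(n := y)) \<partial>?P n) \<partial>M)"
    proof (intro integral_mono integrable_sign_avg slice(4)[OF H[OF \<epsilon>]] slice(4)[OF G[OF \<epsilon>]])
      fix y assume "y \<in> space M"
      then show "(\<integral>x. H \<epsilon> (x(n := y)) \<partial>?P n) \<le> sign_avg n (\<lambda>s. \<integral>x. G \<epsilon> s (x(n := y)) \<partial>?P n)"
        unfolding H_upd G_upd using c'[OF \<epsilon>] by (intro Suc.IH) blast
    qed
    also have "\<dots> = sign_avg n (\<lambda>s. \<integral>y. (\<integral>x. G \<epsilon> s (x(n := y)) \<partial>?P n) \<partial>M)"
      by (intro integral_sign_avg slice(4)[OF G[OF \<epsilon>]])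
    also have "\<dots> = sign_avg n (\<lambda>s. \<integral>x. G \<epsilon> s x \<partial>?P (Suc n))"
    proof (intro sign_avg_cong)
      fix s assume "s \<in> signs n"
      from slice(1)[OF G[OF \<epsilon> this]]
      show "(\<integral>y. (\<integral>x. G \<epsilon> s (x(n := y)) \<partial>?P n) \<partial>M) = (\<integral>x. G \<epsilon> s x \<partial>?P (Suc n))"
        unfolding eq by (intro PP.product_integral_insert_rev[symmetric]) auto
    qed
    finally show ?thesis .
  qed
  have "(\<integral>x. F x \<partial>?P (Suc n)) = (\<integral>x. (\<integral>y. F (x(n := y)) \<partial>M) \<partial>?P n)"
    using slice(1)[OF F] unfolding eq by (intro PP.product_integral_insert) auto
  also have "\<dots> \<le> (\<integral>x. ((\<integral>y. H 1 (x(n := y)) \<partial>M) + (\<integral>y. H (-1) (x(n := y)) \<partial>M)) / 2 \<partial>?P n)"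
  proof (intro integral_mono slice(5)[OF F] Bochner_Integration.integrable_divide Bochner_Integration.integrable_add slice(5)[OF H])
    fix x assume x: "x \<in> space (?P n)"
    have "\<bar>c z + ?D x z\<bar> \<le> A + real n * (2 * B)" if "z \<in> Z" for z
      using that Suc.prems x by (intro order_trans[OF abs_triangle_ineq] add_mono D_le) auto
    from symmetrization_single[OF Z f B this]
    show "(\<integral>y. F (x(n := y)) \<partial>M) \<le> ((\<integral>y. H 1 (x(n := y)) \<partial>M) + (\<integral>y. H (-1) (x(n := y)) \<partial>M)) / 2"
      by (simp add: H_upd F_def algebra_simps)
  qed auto
  also have "\<dots> = ((\<integral>x. (\<integral>y. H 1 (x(n := y)) \<partial>M) \<partial>?P n) + (\<integral>x. (\<integral>y. H (-1) (x(n := y)) \<partial>M) \<partial>?P n)) / 2"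
    using slice(5)[OF H, of 1] slice(5)[OF H, of "-1"] by simp
  also have "\<dots> = ((\<integral>x. H 1 x \<partial>?P (Suc n)) + (\<integral>x. H (-1) x \<partial>?P (Suc n))) / 2"
    using slice(1)[OF H, of 1] slice(1)[OF H, of "-1"] unfolding eq
    by (simp add: PP.product_integral_insert)
  also have "\<dots> \<le> (sign_avg n (\<lambda>s. \<integral>x. G 1 s x \<partial>?P (Suc n)) + sign_avg n (\<lambda>s. \<integral>x. G (-1) s x \<partial>?P (Suc n))) / 2"
    by (intro divide_right_mono add_mono half) auto
  also have "\<dots> = sign_avg (Suc n) (\<lambda>s. \<integral>x. (SUP z\<in>Z. \<bar>c z + 2 * (\<Sum>j<Suc n. s j * f z (x j))\<bar>) \<partial>?P (Suc n))"
    by (simp add: sign_avg_Suc G_def algebra_simps)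
  finally show ?case
    by (simp add: F_def)
qed

section \<open>Uniform deviation of bounded features\<close>

text \<open>\<open>\<kappa>\<close> is the derivative of the composite at \<open>C\<close>. The
  inner root, the logarithm and the outer root are bounded by their tangents in turn, and
  monotonicity of the outer functions lets these bounds compose.\<close>

lemma sqrt_ln_sqrt_le_tangent:
  fixes c C :: real
  assumes "0 < C" "0 \<le> c"
  defines "\<kappa> \<equiv> 1 / (2 * sqrt C * (1 + sqrt C) * (2 * sqrt (ln (1 + sqrt C))))"
  shows "sqrt (ln (1 + sqrt c)) \<le> sqrt (ln (1 + sqrt C)) + \<kappa> * (c - C)"
proof -
  define A where "A = ln (1 + sqrt C)"
  define x where "x = (c - C) / (2 * sqrt C) / (1 + sqrt C)"
  have A: "0 < A"
    unfolding A_def using \<open>0 < C\<close> by (intro ln_gt_zero) simp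
  have pos: "0 < 1 + sqrt C" "0 < 1 + sqrt c"
    using assms by (auto intro: add_pos_nonneg)
  have "sqrt c \<le> sqrt C + (c - C) / (2 * sqrt C)"
    using sqrt_add_le_tangent[of C "c - C"] assms by simp
  then have "(sqrt c - sqrt C) / (1 + sqrt C) \<le> x"
    unfolding x_def using pos by (intro divide_right_mono) auto
  moreover have "ln (1 + sqrt c) - ln (1 + sqrt C) = ln ((1 + sqrt c) / (1 + sqrt C))"
    using pos by (simp add: ln_divide_pos)
  moreover have "ln ((1 + sqrt c) / (1 + sqrt C)) \<le> (1 + sqrt c) / (1 + sqrt C) - 1"
    using pos by (intro ln_le_minus_one) simp
  moreover have "(1 + sqrt c) / (1 + sqrt C) - 1 = (sqrt c - sqrt C) / (1 + sqrt C)"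
    using pos by (simp add: field_simps)
  ultimately have le: "ln (1 + sqrt c) \<le> A + x"
    by (simp add: A_def)
  have "0 \<le> ln (1 + sqrt c)"
    using assms by simp
  then have "sqrt (ln (1 + sqrt c)) \<le> sqrt A + x / (2 * sqrt A)"
    using le A sqrt_add_le_tangent[of A x] by (meson order_trans real_sqrt_le_mono)
  also have "x / (2 * sqrt A) = \<kappa> * (c - C)"
    by (simp add: x_def \<kappa>_def A_def)
  finally show ?thesis
    by (simp add: A_def)
qed

text \<open>Jensen's inequality by integrating a tangent. The slope is infinite at 0, where the mean
  may lie; so the tangent is taken at points above the mean, and continuity lets them decrease to
  it.\<close>

lemma (in prob_space) expectation_sqrt_ln_sqrt_le:
  fixes c :: "'a \<Rightarrow> real"
  assumes c: "integrable M c" and c0: "\<And>x. x \<in> space M \<Longrightarrow> 0 \<le> c x"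
  shows "integrable M (\<lambda>x. sqrt (ln (1 + sqrt (c x))))"
    and "expectation (\<lambda>x. sqrt (ln (1 + sqrt (c x)))) \<le> sqrt (ln (1 + sqrt (expectation c)))"
proof -
  define C where "C = expectation c"
  define \<phi> where "\<phi> c = sqrt (ln (1 + sqrt c))" for c :: real
  define \<kappa> where "\<kappa> C = 1 / (2 * sqrt C * (1 + sqrt C) * (2 * sqrt (ln (1 + sqrt C))))" for C :: real
  have [measurable]: "c \<in> borel_measurable M"
    using c by auto
  have tangent: "\<phi> (c x) \<le> \<phi> C' + \<kappa> C' * (c x - C')" if "0 < C'" "x \<in> space M" for C' x
    unfolding \<phi>_def \<kappa>_def using that c0 by (intro sqrt_ln_sqrt_le_tangent) auto
  have \<phi>0: "0 \<le> \<phi> (c x)" if "x \<in> space M" for x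
    unfolding \<phi>_def using c0[OF that] by simp
  show int: "integrable M (\<lambda>x. sqrt (ln (1 + sqrt (c x))))"
  proof (rule Bochner_Integration.integrable_bound)
    \<comment> \<open>The tangent at the point 1 is affine in \<open>c x\<close>, so it is an
      integrable majorant.\<close>
    show "integrable M (\<lambda>x. \<phi> 1 + \<kappa> 1 * (c x - 1))"
      using c by simp
    show "AE x in M. norm (sqrt (ln (1 + sqrt (c x)))) \<le> norm (\<phi> 1 + \<kappa> 1 * (c x - 1))"
      using tangent[of 1] \<phi>0 by (intro AE_I2) (fastforce simp: \<phi>_def)
  qed measurable
  have C0: "0 \<le> C"
    unfolding C_def using c0 by (intro integral_nonneg_AE AE_I2)
  have le: "expectation (\<lambda>x. \<phi> (c x)) \<le> \<phi> C'" if "0 < C'" "C \<le> C'" for C'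
  proof -
    have "expectation (\<lambda>x. \<phi> (c x)) \<le> expectation (\<lambda>x. \<phi> C' + \<kappa> C' * (c x - C'))"
      using c int tangent that by (intro integral_mono) (auto simp: \<phi>_def)
    also have "\<dots> = \<phi> C' + \<kappa> C' * (C - C')"
      using c by (simp add: prob_space C_def)
    also have "\<dots> \<le> \<phi> C'"
    proof -
      have "0 \<le> \<kappa> C'"
        using that by (auto simp: \<kappa>_def)
      then have "\<kappa> C' * (C - C') \<le> 0"
        using that by (intro mult_nonneg_nonpos) auto
      then show ?thesis
        by simp
    qed
    finally show ?thesis .
  qed
  have "(\<lambda>n. C + inverse (real (Suc n))) \<longlonglongrightarrow> C"
    using LIMSEQ_inverse_real_of_nat_add by blast
  then have "(\<lambda>n. \<phi> (C + inverse (real (Suc n)))) \<longlonglongrightarrow> \<phi> C"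
    unfolding \<phi>_def using add_pos_nonneg[OF zero_less_one real_sqrt_ge_zero[OF C0]]
    by (intro tendsto_intros; metis less_irrefl)
  moreover have "expectation (\<lambda>x. \<phi> (c x)) \<le> \<phi> (C + inverse (real (Suc n)))" for n
    using C0 by (intro le) (auto intro: add_nonneg_pos)
  ultimately have "expectation (\<lambda>x. \<phi> (c x)) \<le> \<phi> C"
    by (intro LIMSEQ_le_const) auto
  then show "expectation (\<lambda>x. sqrt (ln (1 + sqrt (c x)))) \<le> sqrt (ln (1 + sqrt (expectation c)))"
    by (simp add: \<phi>_def C_def)
qed

lemma (in prob_space) integral_PiM_component:
  fixes g :: "'a \<Rightarrow> real"
  assumes "i \<in> I" and g: "integrable M g"
  shows "integrable (Pi\<^sub>M I (\<lambda>_. M)) (\<lambda>x. g (x i))" and "(\<integral>x. g (x i) \<partial>Pi\<^sub>M I (\<lambda>_. M)) = expectation g"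
proof -
  interpret PP: product_prob_space "\<lambda>_. M" I
    by unfold_locales
  have *: "distr (Pi\<^sub>M I (\<lambda>_. M)) M (\<lambda>x. x i) = M"
    using PP.PiM_component[OF \<open>i \<in> I\<close>] .
  have [measurable]: "(\<lambda>x. x i) \<in> measurable (Pi\<^sub>M I (\<lambda>_. M)) M"
    using \<open>i \<in> I\<close> by (rule measurable_component_singleton)
  have [measurable]: "g \<in> borel_measurable M"
    using g by auto
  show "integrable (Pi\<^sub>M I (\<lambda>_. M)) (\<lambda>x. g (x i))"
    using g by (subst (asm) *[symmetric], subst (asm) integrable_distr_eq) auto
  show "(\<integral>x. g (x i) \<partial>Pi\<^sub>M I (\<lambda>_. M)) = expectation g"
    by (subst (2) *[symmetric], subst integral_distr) auto
qed

text \<open>For a sample \<open>x\<close> the square of \<open>L\<close> is the empirical mean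
  \<open>c x\<close>, whose expectation is \<open>C\<close>. Exchanging the sign average with the
  integral allows the conditional chaining bound to be applied for each \<open>x\<close>.\<close>

lemma expected_feature_deviation:
  fixes M :: "'a::euclidean_space measure" and w :: "'a \<Rightarrow> real" and h :: "real \<Rightarrow> real" and m :: nat
  assumes "prob_space M" and sets_M: "sets M = sets borel"
    and w: "w \<in> borel_measurable borel" "\<And>\<omega>. \<bar>w \<omega>\<bar> \<le> T"
    and lip: "\<And>x y. \<bar>h x - h y\<bar> \<le> \<bar>x - y\<bar>" and h1: "\<And>x. \<bar>h x\<bar> \<le> 1"
    and Z: "countable Z" "Z \<noteq> {}" "Z \<subseteq> cball 0 r"
    and pos: "0 < m" "0 < T" "0 \<le> r"
    and U: "U = ln (1 + 2 * r / T)" "0 < U"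
    and int: "integrable M (\<lambda>\<omega>. (w \<omega>)\<^sup>2 * (norm \<omega>)\<^sup>2)"
    and C: "C = (\<integral>\<omega>. (w \<omega>)\<^sup>2 * (norm \<omega>)\<^sup>2 \<partial>M)"
  defines "f \<equiv> \<lambda>z \<omega>. w \<omega> * h (\<omega> \<bullet> z)"
  shows "(\<integral>x. (SUP z\<in>Z. \<bar>\<Sum>j<m. f z (x j) - integral\<^sup>L M (f z)\<bar>) \<partial>Pi\<^sub>M {..<m} (\<lambda>_. M))
    \<le> 32 * (T * sqrt m * (sqrt (2 * real DIM('a)) * (sqrt U + 1 / (2 * sqrt U) + sqrt (ln (1 + sqrt C)))))"
proof -
  interpret prob_space M
    by fact
  let ?P = "Pi\<^sub>M {..<m} (\<lambda>_. M)"
  interpret P: prob_space ?P by (intro prob_space_PiM prob_space_axioms)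
  define V where "V = sqrt U + 1 / (2 * sqrt U)"
  define c where "c x = (\<Sum>j<m. (w (x j))\<^sup>2 * (norm (x j))\<^sup>2) / real m" for x
  define K where "K = T * sqrt m * sqrt (2 * real DIM('a))"
  have "0 \<le> K"
    using pos by (simp add: K_def)
  have "0 \<le> V"
    using U by (simp add: V_def)
  have [measurable]: "w \<in> borel_measurable M"
    using w(1) sets_M by (simp cong: measurable_cong_sets)
  have "continuous_on UNIV h"
    using lip by (intro lipschitz_on_continuous_on[of 1] lipschitz_onI) (auto simp: dist_real_def)
  then have h_meas: "h \<in> borel_measurable borel"
    by (rule borel_measurable_continuous_onI)
  have ident [measurable]: "(\<lambda>\<omega>. \<omega>) \<in> borel_measurable M"
    using sets_M by (simp cong: measurable_cong_sets)
  have f_meas: "f z \<in> borel_measurable M" for z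
    unfolding f_def using measurable_compose[OF _ h_meas] by measurable
  have f_bound: "\<bar>f z \<omega>\<bar> \<le> T" for z \<omega>
    using mult_mono[OF w(2)[of \<omega>] h1[of "\<omega> \<bullet> z"]] pos by (simp add: f_def abs_mult)
  have sum_f_bound: "\<bar>2 * (\<Sum>j<m. s j * f z (x j))\<bar> \<le> 2 * (real m * T)" if "s \<in> signs m" for s z x
  proof -
    have "\<bar>\<Sum>j<m. s j * f z (x j)\<bar> \<le> (\<Sum>j<m. \<bar>s j * f z (x j)\<bar>)"
      by (rule sum_abs)
    also have "\<dots> \<le> (\<Sum>j<m. T)"
      using that f_bound by (intro sum_mono) (auto simp: abs_mult signs_abs)
    finally show ?thesis
      by simp
  qed
  have c_int: "integrable ?P c" and c_eq: "(\<integral>x. c x \<partial>?P) = C"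
  proof -
    have *: "integrable ?P (\<lambda>x. (w (x j))\<^sup>2 * (norm (x j))\<^sup>2)"
        "(\<integral>x. (w (x j))\<^sup>2 * (norm (x j))\<^sup>2 \<partial>?P) = C" if "j \<in> {..<m}" for j
      unfolding C using integral_PiM_component[OF that int] by auto
    show "integrable ?P c"
      unfolding c_def by (intro Bochner_Integration.integrable_divide Bochner_Integration.integrable_sum *)
    show "(\<integral>x. c x \<partial>?P) = C"
      unfolding c_def using * pos by (simp add: Bochner_Integration.integral_sum)
  qed
  have c0: "0 \<le> c x" for x
    by (auto simp: c_def intro!: divide_nonneg_nonneg sum_nonneg)
  note ln_c = P.expectation_sqrt_ln_sqrt_le[OF c_int c0]
  define R where "R s x = (SUP z\<in>Z. \<bar>2 * (\<Sum>j<m. s j * f z (x j))\<bar>)" for s x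
  have R_int: "integrable ?P (R s)" if "s \<in> signs m" for s
    unfolding R_def[abs_def]
  proof (rule P.integrable_SUP_abs[OF Z(1,2)])
    show "(\<lambda>x. 2 * (\<Sum>j<m. s j * f z (x j))) \<in> borel_measurable ?P" for z
      by (intro borel_measurable_times borel_measurable_const borel_measurable_sum
          measurable_compose[OF _ f_meas] measurable_component_singleton) auto
  qed (rule sum_f_bound[OF that])
  have R_avg: "sign_avg m (\<lambda>s. R s x) \<le> 14 * (K * (V + sqrt (ln (1 + sqrt (c x)))))" for x
  proof -
    have "sign_avg m (\<lambda>s. R s x) \<le> sign_avg m (\<lambda>s. 2 * (SUP z\<in>Z. \<bar>\<Sum>j<m. s j * (w (x j) * h (x j \<bullet> z))\<bar>))"
    proof (rule sign_avg_mono)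
      fix s assume s: "s \<in> signs m"
      show "R s x \<le> 2 * (SUP z\<in>Z. \<bar>\<Sum>j<m. s j * (w (x j) * h (x j \<bullet> z))\<bar>)"
        unfolding R_def
      proof (intro cSUP_least Z)
        fix z assume "z \<in> Z"
        then have "\<bar>\<Sum>j<m. s j * f z (x j)\<bar> \<le> (SUP z\<in>Z. \<bar>\<Sum>j<m. s j * f z (x j)\<bar>)"
          using sum_f_bound[OF s, of _ x] by (intro cSUP_upper bdd_aboveI2[where M = "real m * T"]) (auto simp: abs_mult)
        then show "\<bar>2 * (\<Sum>j<m. s j * f z (x j))\<bar> \<le> 2 * (SUP z\<in>Z. \<bar>\<Sum>j<m. s j * (w (x j) * h (x j \<bullet> z))\<bar>)"
          by (simp add: abs_mult f_def)
      qed
    qed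
    also have "\<dots> = 2 * sign_avg m (\<lambda>s. SUP z\<in>Z. \<bar>\<Sum>j<m. s j * (w (x j) * h (x j \<bullet> z))\<bar>)"
      by (rule sign_avg_cmult)
    also have "\<dots> \<le> 2 * (7 * (T * sqrt m * (sqrt (2 * real DIM('a)) * (sqrt U + 1 / (2 * sqrt U) + sqrt (ln (1 + sqrt (c x)))))))"
      using pos Z lip h1 w(2) U by (intro mult_left_mono sign_avg_SUP_chaining[where L = "sqrt (c x)"]) (auto simp: c_def)
    finally show ?thesis
      by (simp add: K_def V_def mult.assoc)
  qed
  have "(\<integral>x. (SUP z\<in>Z. \<bar>0 + (\<Sum>j<m. f z (x j) - expectation (f z))\<bar>) \<partial>?P)
      \<le> sign_avg m (\<lambda>s. \<integral>x. (SUP z\<in>Z. \<bar>0 + 2 * (\<Sum>j<m. s j * f z (x j))\<bar>) \<partial>?P)"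
    by (rule symmetrization[OF Z(1,2) f_meas f_bound, where A = 0]) simp
  then have "(\<integral>x. (SUP z\<in>Z. \<bar>\<Sum>j<m. f z (x j) - expectation (f z)\<bar>) \<partial>?P) \<le> sign_avg m (\<lambda>s. \<integral>x. R s x \<partial>?P)"
    by (simp add: R_def)
  also have "\<dots> = (\<integral>x. sign_avg m (\<lambda>s. R s x) \<partial>?P)"
    by (rule integral_sign_avg[symmetric]) (rule R_int)
  also have "\<dots> \<le> (\<integral>x. 14 * (K * (V + sqrt (ln (1 + sqrt (c x))))) \<partial>?P)"
    using ln_c(1) by (intro integral_mono R_avg integrable_sign_avg R_int) auto
  also have "\<dots> = 14 * (K * (V + (\<integral>x. sqrt (ln (1 + sqrt (c x))) \<partial>?P)))"
    using ln_c(1) by (simp add: P.prob_space)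
  also have "\<dots> \<le> 14 * (K * (V + sqrt (ln (1 + sqrt C))))"
    using ln_c(2) c_eq \<open>0 \<le> K\<close> by (intro mult_left_mono add_left_mono) auto
  \<comment> \<open>The 14 is the 2 of symmetrization times the 7 of chaining; 32 is the constant of
    the claim.\<close>
  also have "\<dots> \<le> 32 * (K * (V + sqrt (ln (1 + sqrt C))))"
  proof (intro mult_right_mono mult_nonneg_nonneg add_nonneg_nonneg)
    have "0 \<le> C"
      unfolding C by (intro integral_nonneg_AE AE_I2) auto
    then show "0 \<le> sqrt (ln (1 + sqrt C))"
      by simp
  qed (use \<open>0 \<le> K\<close> \<open>0 \<le> V\<close> in auto)
  finally show ?thesis
    by (simp add: K_def V_def mult.assoc)
qed

text \<open>A supremum of absolute values is 1-Lipschitz for the uniform distance. This turns a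
  bound on each summand's change into the bounded-differences condition.\<close>

lemma abs_SUP_abs_diff_le:
  fixes g g' :: "'i \<Rightarrow> real"
  assumes "Z \<noteq> {}" and "\<And>z. z \<in> Z \<Longrightarrow> \<bar>g z\<bar> \<le> A" "\<And>z. z \<in> Z \<Longrightarrow> \<bar>g' z\<bar> \<le> A"
    and K: "\<And>z. z \<in> Z \<Longrightarrow> \<bar>g z - g' z\<bar> \<le> K"
  shows "\<bar>(SUP z\<in>Z. \<bar>g z\<bar>) - (SUP z\<in>Z. \<bar>g' z\<bar>)\<bar> \<le> K"
proof -
  have *: "(SUP z\<in>Z. \<bar>a z\<bar>) \<le> (SUP z\<in>Z. \<bar>b z\<bar>) + K"
    if b: "\<And>z. z \<in> Z \<Longrightarrow> \<bar>b z\<bar> \<le> A" and d: "\<And>z. z \<in> Z \<Longrightarrow> \<bar>a z - b z\<bar> \<le> K" for a b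
  proof (intro cSUP_least assms(1))
    fix z assume z: "z \<in> Z"
    have "\<bar>b z\<bar> \<le> (SUP z\<in>Z. \<bar>b z\<bar>)"
      using z b by (intro cSUP_upper bdd_aboveI2[where M = A])
    then show "\<bar>a z\<bar> \<le> (SUP z\<in>Z. \<bar>b z\<bar>) + K"
      using d[OF z] by linarith
  qed
  show ?thesis
    using *[of g' g] *[of g g'] assms by (auto simp: abs_le_iff abs_minus_commute)
qed

text \<open>The features and their means are continuous in \<open>z\<close>, so a countable dense
  subset \<open>Z\<close> of \<open>D\<close> yields the same supremum; this makes the event
  measurable and gives the expectation bound access to \<open>D\<close>.\<close>

lemma feature_deviation_tail:
  fixes M :: "'a::euclidean_space measure" and w :: "'a \<Rightarrow> real" and h :: "real \<Rightarrow> real" and m :: nat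
  assumes prob: "prob_space M" and sets_M: "sets M = sets borel"
    and w: "w \<in> borel_measurable borel" "\<And>\<omega>. \<bar>w \<omega>\<bar> \<le> T"
    and lip: "\<And>x y. \<bar>h x - h y\<bar> \<le> \<bar>x - y\<bar>" and h1: "\<And>x. \<bar>h x\<bar> \<le> 1"
    and D: "D \<noteq> {}" "D \<subseteq> cball 0 r"
    and pos: "0 < m" "0 < T" "0 \<le> r" "0 < \<tau>"
    and U: "U = ln (1 + 2 * r / T)" "0 < U"
    and int: "integrable M (\<lambda>\<omega>. (w \<omega>)\<^sup>2 * (norm \<omega>)\<^sup>2)"
    and C: "C = (\<integral>\<omega>. (w \<omega>)\<^sup>2 * (norm \<omega>)\<^sup>2 \<partial>M)"
    and H: "H = 32 * (T * (sqrt (2 * real DIM('a)) * (sqrt U + 1 / (2 * sqrt U) + sqrt (ln (1 + sqrt C)))))"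
  defines "f \<equiv> \<lambda>z \<omega>. w \<omega> * h (\<omega> \<bullet> z)"
  defines "E \<equiv> {x \<in> space (Pi\<^sub>M {..<m} (\<lambda>_. M)).
      sqrt m * (H + T * sqrt (2 * \<tau>)) \<le> (SUP z\<in>D. \<bar>\<Sum>j<m. f z (x j) - integral\<^sup>L M (f z)\<bar>)}"
  shows "E \<in> sets (Pi\<^sub>M {..<m} (\<lambda>_. M))" and "measure (Pi\<^sub>M {..<m} (\<lambda>_. M)) E \<le> exp (- \<tau>)"
proof -
  interpret prob_space M
    by fact
  let ?P = "Pi\<^sub>M {..<m} (\<lambda>_. M)"
  interpret P: prob_space ?P by (intro prob_space_PiM prob_space_axioms)
  have [measurable]: "w \<in> borel_measurable M"
    using w(1) sets_M by (simp cong: measurable_cong_sets)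
  have cont_h: "continuous_on UNIV h"
    using lip by (intro lipschitz_on_continuous_on[of 1] lipschitz_onI) (auto simp: dist_real_def)
  then have h_meas: "h \<in> borel_measurable borel"
    by (rule borel_measurable_continuous_onI)
  have ident [measurable]: "(\<lambda>\<omega>. \<omega>) \<in> borel_measurable M"
    using sets_M by (simp cong: measurable_cong_sets)
  have f_meas: "f z \<in> borel_measurable M" for z
    unfolding f_def using measurable_compose[OF _ h_meas] by measurable
  have f_bound: "\<bar>f z \<omega>\<bar> \<le> T" for z \<omega>
    using mult_mono[OF w(2)[of \<omega>] h1[of "\<omega> \<bullet> z"]] pos by (simp add: f_def abs_mult)
  have f_int: "integrable M (f z)" for z
    using f_meas f_bound by (intro integrable_const_bound[where B = T]) auto
  have Ef_bound: "\<bar>integral\<^sup>L M (f z)\<bar> \<le> T" for z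
  proof -
    have "\<bar>integral\<^sup>L M (f z)\<bar> \<le> (\<integral>y. T \<partial>M)"
      using f_int f_bound by (intro order_trans[OF integral_abs_bound] integral_mono) auto
    then show ?thesis
      by (simp add: prob_space)
  qed
  define g where "g x z = (\<Sum>j<m. f z (x j) - integral\<^sup>L M (f z))" for x z
  have g_bound: "\<bar>g x z\<bar> \<le> real m * (2 * T)" for x z
  proof -
    have "\<bar>g x z\<bar> \<le> (\<Sum>j<m. \<bar>f z (x j) - integral\<^sup>L M (f z)\<bar>)"
      unfolding g_def by (rule sum_abs)
    also have "\<dots> \<le> (\<Sum>j<m. 2 * T)"
    proof (rule sum_mono)
      show "\<bar>f z (x j) - integral\<^sup>L M (f z)\<bar> \<le> 2 * T" for j
        using f_bound[of z "x j"] Ef_bound[of z] by simp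
    qed
    finally show ?thesis
      by simp
  qed
  obtain Z where Z: "countable Z" "Z \<subseteq> D" "D \<subseteq> closure Z"
    using separable by blast
  have Z_ne: "Z \<noteq> {}"
    using D Z by auto
  define \<Delta> where "\<Delta> x = (SUP z\<in>Z. \<bar>g x z\<bar>)" for x
  have \<Delta>_eq: "(SUP z\<in>D. \<bar>g x z\<bar>) = \<Delta> x" for x
  proof (rule antisym)
    show "(SUP z\<in>D. \<bar>g x z\<bar>) \<le> \<Delta> x"
    proof (intro cSUP_least D)
      fix z assume "z \<in> D"
      then obtain \<zeta> where \<zeta>: "\<And>n. \<zeta> n \<in> Z" "\<zeta> \<longlonglongrightarrow> z"
        using Z closure_sequential by blast
      have f_lim: "(\<lambda>n. f (\<zeta> n) \<omega>) \<longlonglongrightarrow> f z \<omega>" for \<omega>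
        unfolding f_def using \<zeta>(2)
        by (intro tendsto_intros continuous_on_tendsto_compose[OF cont_h]) auto
      have "(\<lambda>n. integral\<^sup>L M (f (\<zeta> n))) \<longlonglongrightarrow> integral\<^sup>L M (f z)"
        using f_meas f_lim f_bound by (intro integral_dominated_convergence[where w = "\<lambda>_. T"]) auto
      then have "(\<lambda>n. \<bar>g x (\<zeta> n)\<bar>) \<longlonglongrightarrow> \<bar>g x z\<bar>"
        unfolding g_def by (intro tendsto_intros f_lim)
      moreover have "\<bar>g x (\<zeta> n)\<bar> \<le> \<Delta> x" for n
        unfolding \<Delta>_def using \<zeta> g_bound by (intro cSUP_upper bdd_aboveI2)
      ultimately show "\<bar>g x z\<bar> \<le> \<Delta> x"
        by (intro LIMSEQ_le_const2) auto
    qed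
    show "\<Delta> x \<le> (SUP z\<in>D. \<bar>g x z\<bar>)"
      unfolding \<Delta>_def using Z Z_ne g_bound by (intro cSUP_subset_mono bdd_aboveI2) auto
  qed
  have E_eq: "E = {x \<in> space ?P. sqrt m * (H + T * sqrt (2 * \<tau>)) \<le> \<Delta> x}"
    by (simp add: E_def \<Delta>_eq g_def[symmetric])
  have \<Delta>_meas [measurable]: "\<Delta> \<in> borel_measurable ?P"
    unfolding \<Delta>_def[abs_def]
  proof (rule borel_measurable_SUP_abs[OF Z(1)])
    show "(\<lambda>x. g x z) \<in> borel_measurable ?P" for z
      unfolding g_def
      by (intro borel_measurable_sum borel_measurable_diff borel_measurable_const
          measurable_compose[OF _ f_meas] measurable_component_singleton) auto
  qed (rule g_bound)
  show "E \<in> sets ?P"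
    unfolding E_eq by measurable
  have \<Delta>_diff: "\<bar>\<Delta> (x(j := y)) - \<Delta> x\<bar> \<le> 2 * T" if "j < m" for x j y
    unfolding \<Delta>_def
  proof (rule abs_SUP_abs_diff_le[OF Z_ne g_bound g_bound])
    fix z
    have "g (x(j := y)) z - g x z = (\<Sum>i<m. f z ((x(j := y)) i) - f z (x i))"
      by (simp add: g_def sum_subtractf)
    also have "\<dots> = (\<Sum>i<m. if i = j then f z y - f z (x j) else 0)"
      by (intro sum.cong) auto
    also have "\<dots> = f z y - f z (x j)"
      using that by simp
    finally show "\<bar>g (x(j := y)) z - g x z\<bar> \<le> 2 * T"
      using f_bound[of z y] f_bound[of z "x j"] by simp
  qed
  \<comment> \<open>Replacing one frequency changes one summand, by at most \<open>2 * T\<close>.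
    With these differences this \<open>t\<close> makes McDiarmid's exponent exactly
    \<open>- \<tau>\<close>.\<close>
  define t where "t = sqrt m * (T * sqrt (2 * \<tau>))"
  have "(\<integral>x. \<Delta> x \<partial>?P) \<le> sqrt m * H"
    using expected_feature_deviation[OF prob sets_M w lip h1 Z(1) Z_ne _ pos(1-3) U int C] Z(2) D(2)
    by (simp add: \<Delta>_def g_def f_def H mult_ac)
  then have "E \<subseteq> {x \<in> space ?P. (\<integral>x. \<Delta> x \<partial>?P) + t \<le> \<Delta> x}"
    by (auto simp: E_eq t_def distrib_left)
  then have "measure ?P E \<le> measure ?P {x \<in> space ?P. (\<integral>x. \<Delta> x \<partial>?P) + t \<le> \<Delta> x}"
    by (intro P.finite_measure_mono) measurable
  also have "\<dots> \<le> exp (- (2 * t\<^sup>2 / (real m * (2 * T)\<^sup>2)))"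
  proof (rule McDiarmid_ineq_ge[OF \<Delta>_meas])
    show "\<bar>\<Delta> x\<bar> \<le> real m * (2 * T)" for x
      unfolding \<Delta>_def by (rule SUP_abs_le[OF Z_ne g_bound])
  qed (use \<Delta>_diff pos in \<open>auto simp: t_def\<close>)
  also have "2 * t\<^sup>2 / (real m * (2 * T)\<^sup>2) = \<tau>"
    using pos by (simp add: t_def power_mult_distrib)
  finally show "measure ?P E \<le> exp (- \<tau>)" .
qed

section \<open>Derivatives of the kernel\<close>

lemma abs_cos_diff_le: "\<bar>cos x - cos y\<bar> \<le> \<bar>x - y\<bar>" for x y :: real
  using field_differentiable_bound[of UNIV cos "\<lambda>x. - sin x" 1 x y]
  by (auto intro!: derivative_eq_intros)

lemma abs_sin_diff_le: "\<bar>sin x - sin y\<bar> \<le> \<bar>x - y\<bar>" for x y :: real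
  using field_differentiable_bound[of UNIV sin cos 1 x y]
  by (auto intro!: derivative_eq_intros)

text \<open>The function \<open>cos (a + t) + t * sin a\<close> of \<open>t\<close> has a derivative
  of size at most \<open>\<bar>s\<bar>\<close> on the interval considered. The remainder is uniform
  in the phase \<open>a\<close>, so it survives integration over frequencies.\<close>

lemma cos_add_linear_approx: "\<bar>cos (a + s) - cos a + s * sin a\<bar> \<le> s\<^sup>2" for a s :: real
proof -
  have "norm ((cos (a + s) + s * sin a) - (cos (a + 0) + 0 * sin a)) \<le> \<bar>s\<bar> * norm (s - 0)"
  proof (rule field_differentiable_bound)
    show "((\<lambda>t. cos (a + t) + t * sin a) has_field_derivative (sin a - sin (a + t))) (at t within cball 0 \<bar>s\<bar>)" for t
      by (auto intro!: derivative_eq_intros)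
    show "norm (sin a - sin (a + t)) \<le> \<bar>s\<bar>" if "t \<in> cball 0 \<bar>s\<bar>" for t
      using abs_sin_diff_le[of a "a + t"] that by simp
  qed auto
  then show ?thesis
    by (simp add: power2_eq_square algebra_simps abs_mult[symmetric])
qed

text \<open>With the uniform remainder of the cosine, this criterion differentiates an integral
  directly, without interchanging a limit and an integral.\<close>

lemma has_field_derivative_quadratic_remainder:
  fixes f :: "real \<Rightarrow> real"
  assumes "\<And>t. \<bar>f t - f 0 - t * D\<bar> \<le> K * t\<^sup>2"
  shows "(f has_field_derivative D) (at 0)"
proof -
  have "((\<lambda>t. (f t - f 0) / t - D) \<longlongrightarrow> 0) (at 0)"
  proof (rule Lim_null_comparison)
    show "\<forall>\<^sub>F t in at 0. norm ((f t - f 0) / t - D) \<le> K * \<bar>t\<bar>"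
    proof (intro eventually_at_filter[THEN iffD2] always_eventually allI impI)
      fix t :: real assume t: "t \<noteq> 0"
      have "\<bar>(f t - f 0) / t - D\<bar> = \<bar>f t - f 0 - t * D\<bar> / \<bar>t\<bar>"
        using t by (simp add: abs_divide[symmetric] diff_divide_distrib)
      also have "\<dots> \<le> K * t\<^sup>2 / \<bar>t\<bar>"
        by (intro divide_right_mono assms) simp
      also have "\<dots> = K * \<bar>t\<bar>"
        using t by (simp add: power2_eq_square abs_if)
      finally show "norm ((f t - f 0) / t - D) \<le> K * \<bar>t\<bar>"
        by simp
    qed
    show "((\<lambda>t. K * \<bar>t\<bar>) \<longlongrightarrow> 0) (at 0)"
      by (auto intro!: tendsto_eq_intros)
  qed
  then show ?thesis
    unfolding DERIV_def by (simp add: LIM_zero_cancel)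
qed

text \<open>The frequency is a random vector \<open>v\<close> rather than the sample point, because
  the kernel is differentiated in \<open>x\<close> with frequency \<open>\<omega>\<close> and in
  \<open>y\<close> with frequency \<open>- \<omega>\<close> over the same measure.\<close>

locale bounded_frequency = prob_space M for M :: "'a measure" +
  fixes v :: "'a \<Rightarrow> real ^ 'n::{finite,linorder}" and R :: real
  assumes v_meas [measurable]: "v \<in> borel_measurable M"
    and v_bound: "AE \<omega> in M. norm (v \<omega>) \<le> R"
begin

definition ess_bounded :: "('a \<Rightarrow> real) \<Rightarrow> bool" where
  "ess_bounded g \<longleftrightarrow> g \<in> borel_measurable M \<and> (\<exists>G. AE \<omega> in M. \<bar>g \<omega>\<bar> \<le> G)"

text \<open>This family is closed under partial derivatives: each one multiplies the amplitude
  \<open>g\<close> by a component of \<open>v\<close> and advances the phase \<open>c\<close> by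
  \<open>pi / 2\<close>, which is where \<open>h_fun\<close> comes from. The phase depends on
  \<open>\<omega>\<close> so that it can hold the other argument of the kernel.\<close>

definition wave :: "('a \<Rightarrow> real) \<Rightarrow> ('a \<Rightarrow> real) \<Rightarrow> (real, 'n) vec \<Rightarrow> real" where
  "wave g c x = (\<integral>\<omega>. g \<omega> * cos (c \<omega> + v \<omega> \<bullet> x) \<partial>M)"

lemma component_measurable [measurable]: "(\<lambda>\<omega>. v \<omega> $ i) \<in> borel_measurable M"
  using borel_measurable_inner[OF v_meas borel_measurable_const[of "axis i 1"]]
  by (simp add: inner_axis)

lemma component_bound: "AE \<omega> in M. \<bar>v \<omega> $ i\<bar> \<le> R"
  using v_bound by eventually_elim (meson component_le_norm_cart order_trans)

lemma ess_bounded_integrable: "ess_bounded g \<Longrightarrow> integrable M g"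
  unfolding ess_bounded_def by (auto intro: integrable_const_bound[where f = g, unfolded real_norm_def])

lemma ess_bounded_mult:
  assumes "ess_bounded f" "ess_bounded g"
  shows "ess_bounded (\<lambda>\<omega>. f \<omega> * g \<omega>)"
proof -
  obtain F G where "AE \<omega> in M. \<bar>f \<omega>\<bar> \<le> F" "AE \<omega> in M. \<bar>g \<omega>\<bar> \<le> G"
    using assms by (auto simp: ess_bounded_def)
  then have "AE \<omega> in M. \<bar>f \<omega> * g \<omega>\<bar> \<le> F * G"
    by eventually_elim (auto simp: abs_mult intro: mult_mono order_trans[OF abs_ge_zero])
  then show ?thesis
    using assms by (auto simp: ess_bounded_def)
qed

lemma ess_bounded_component_power: "ess_bounded (\<lambda>\<omega>. (v \<omega> $ i) ^ k)"
proof -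
  have "AE \<omega> in M. \<bar>(v \<omega> $ i) ^ k\<bar> \<le> R ^ k"
    using component_bound[of i] by eventually_elim (auto simp: power_abs intro: power_mono)
  then show ?thesis
    by (auto simp: ess_bounded_def)
qed

lemma ess_bounded_cos: "c \<in> borel_measurable M \<Longrightarrow> ess_bounded (\<lambda>\<omega>. cos (c \<omega>))"
  unfolding ess_bounded_def by (auto intro!: exI[of _ 1])

lemma partial_wave:
  assumes g: "ess_bounded g" and c [measurable]: "c \<in> borel_measurable M"
  shows "partial i (wave g c) = wave (\<lambda>\<omega>. g \<omega> * v \<omega> $ i) (\<lambda>\<omega>. c \<omega> + pi / 2)"
proof
  fix x
  obtain G where G: "AE \<omega> in M. \<bar>g \<omega>\<bar> \<le> G"
    using g by (auto simp: ess_bounded_def)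
  have [measurable]: "g \<in> borel_measurable M"
    using g by (simp add: ess_bounded_def)
  have gv: "ess_bounded (\<lambda>\<omega>. g \<omega> * v \<omega> $ i)"
    using ess_bounded_mult[OF g ess_bounded_component_power[of i 1]] by simp
  have int_wave: "integrable M (\<lambda>\<omega>. f \<omega> * cos (a \<omega> + v \<omega> \<bullet> y))"
    if "ess_bounded f" "a \<in> borel_measurable M" for f a y
    using that
    by (intro ess_bounded_integrable ess_bounded_mult ess_bounded_cos borel_measurable_add
        borel_measurable_inner v_meas borel_measurable_const)
  let ?D = "wave (\<lambda>\<omega>. g \<omega> * v \<omega> $ i) (\<lambda>\<omega>. c \<omega> + pi / 2) x"
  have "\<bar>wave g c (x + t *\<^sub>R axis i 1) - wave g c (x + 0 *\<^sub>R axis i 1) - t * ?D\<bar> \<le> G * R\<^sup>2 * t\<^sup>2" for t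
  proof -
    define e where "e \<omega> = g \<omega> * cos (c \<omega> + v \<omega> \<bullet> (x + t *\<^sub>R axis i 1)) - g \<omega> * cos (c \<omega> + v \<omega> \<bullet> x)
        - t * (g \<omega> * v \<omega> $ i * cos (c \<omega> + pi / 2 + v \<omega> \<bullet> x))" for \<omega>
    have e_int: "integrable M e"
      unfolding e_def using g gv c
      by (intro Bochner_Integration.integrable_diff integrable_mult_right int_wave) auto
    have "wave g c (x + t *\<^sub>R axis i 1) - wave g c (x + 0 *\<^sub>R axis i 1) - t * ?D = (\<integral>\<omega>. e \<omega> \<partial>M)"
      unfolding wave_def e_def using int_wave[OF g c] int_wave[OF gv, of "\<lambda>\<omega>. c \<omega> + pi / 2"] by simp
    also have "\<bar>\<dots>\<bar> \<le> (\<integral>\<omega>. G * R\<^sup>2 * t\<^sup>2 \<partial>M)"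
    proof (rule order_trans[OF integral_abs_bound], rule integral_mono_AE)
      show "AE \<omega> in M. \<bar>e \<omega>\<bar> \<le> G * R\<^sup>2 * t\<^sup>2"
        using G component_bound[of i]
      proof eventually_elim
        case (elim \<omega>)
        let ?a = "c \<omega> + v \<omega> \<bullet> x" and ?s = "t * v \<omega> $ i"
        have "cos (c \<omega> + pi / 2 + v \<omega> \<bullet> x) = cos (?a + pi / 2)"
          by (simp add: add_ac)
        also have "\<dots> = - sin ?a"
          by (simp add: cos_add)
        finally have "e \<omega> = g \<omega> * (cos (?a + ?s) - cos ?a + ?s * sin ?a)"
          by (simp add: e_def inner_add_right inner_axis algebra_simps)
        then have "\<bar>e \<omega>\<bar> \<le> G * ?s\<^sup>2"
          using elim(1) cos_add_linear_approx[of ?a ?s]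
          by (auto simp: abs_mult intro!: mult_mono intro: order_trans[OF abs_ge_zero])
        also have "\<dots> \<le> G * (t\<^sup>2 * R\<^sup>2)"
        proof -
          have "(v \<omega> $ i)\<^sup>2 \<le> R\<^sup>2"
            using elim(2) by (auto simp: abs_le_square_iff[symmetric])
          moreover have "0 \<le> G"
            using elim(1) by (rule order_trans[OF abs_ge_zero])
          ultimately show ?thesis
            unfolding power_mult_distrib by (intro mult_left_mono) auto
        qed
        finally show ?case
          by (simp add: mult_ac)
      qed
    qed (use e_int in auto)
    finally show ?thesis
      by (simp add: prob_space)
  qed
  then show "partial i (wave g c) x = ?D"
    unfolding partial_def by (intro DERIV_imp_deriv has_field_derivative_quadratic_remainder[where K = "G * R\<^sup>2"])
qed

lemma funpow_partial_wave:
  assumes "ess_bounded g" "c \<in> borel_measurable M"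
  shows "(partial i ^^ k) (wave g c) = wave (\<lambda>\<omega>. g \<omega> * (v \<omega> $ i) ^ k) (\<lambda>\<omega>. c \<omega> + real k * (pi / 2))"
proof (induction k)
  case (Suc k)
  have "(partial i ^^ Suc k) (wave g c) =
      partial i (wave (\<lambda>\<omega>. g \<omega> * (v \<omega> $ i) ^ k) (\<lambda>\<omega>. c \<omega> + real k * (pi / 2)))"
    by (simp add: Suc)
  also have "\<dots> = wave (\<lambda>\<omega>. g \<omega> * (v \<omega> $ i) ^ k * v \<omega> $ i) (\<lambda>\<omega>. c \<omega> + real k * (pi / 2) + pi / 2)"
    using assms by (intro partial_wave ess_bounded_mult ess_bounded_component_power) auto
  finally show ?case
    by (simp add: algebra_simps add_divide_distrib)
qed simp

text \<open>Essential boundedness of the new amplitude is carried along with the formula, since it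
  is what permits the next derivative.\<close>

lemma foldr_partial_wave:
  assumes "ess_bounded g" "c \<in> borel_measurable M"
  shows "foldr (\<lambda>i. partial i ^^ (p $ i)) js (wave g c) =
      wave (\<lambda>\<omega>. g \<omega> * (\<Prod>i\<leftarrow>js. (v \<omega> $ i) ^ (p $ i))) (\<lambda>\<omega>. c \<omega> + real (\<Sum>i\<leftarrow>js. p $ i) * (pi / 2))
    \<and> ess_bounded (\<lambda>\<omega>. g \<omega> * (\<Prod>i\<leftarrow>js. (v \<omega> $ i) ^ (p $ i)))"
proof (induction js)
  case (Cons i js)
  let ?g = "\<lambda>\<omega>. g \<omega> * (\<Prod>i\<leftarrow>js. (v \<omega> $ i) ^ (p $ i))"
  have "ess_bounded (\<lambda>\<omega>. ?g \<omega> * (v \<omega> $ i) ^ (p $ i))"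
    by (intro ess_bounded_mult[of ?g] ess_bounded_component_power conjunct2[OF Cons.IH])
  moreover have "(partial i ^^ (p $ i)) (wave ?g (\<lambda>\<omega>. c \<omega> + real (\<Sum>i\<leftarrow>js. p $ i) * (pi / 2))) =
      wave (\<lambda>\<omega>. ?g \<omega> * (v \<omega> $ i) ^ (p $ i)) (\<lambda>\<omega>. c \<omega> + real (\<Sum>i\<leftarrow>js. p $ i) * (pi / 2) + real (p $ i) * (pi / 2))"
    by (intro funpow_partial_wave conjunct2[OF Cons.IH] borel_measurable_add borel_measurable_const assms(2))
  ultimately show ?case
    by (simp add: conjunct1[OF Cons.IH] mult_ac distrib_right distrib_left add_divide_distrib add_ac)
qed (use assms in simp)

lemma multi_partial_wave:
  assumes "ess_bounded g" "c \<in> borel_measurable M"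
  shows "multi_partial p (wave g c) =
      wave (\<lambda>\<omega>. g \<omega> * mi_pow (v \<omega>) p) (\<lambda>\<omega>. c \<omega> + real (mi_size p) * (pi / 2))"
    and "ess_bounded (\<lambda>\<omega>. g \<omega> * mi_pow (v \<omega>) p)"
proof -
  have "(\<Prod>i\<leftarrow>sorted_list_of_set UNIV. (u $ i) ^ (p $ i)) = mi_pow u p" for u :: "(real, 'n) vec"
    unfolding mi_pow_def by (simp add: prod.distinct_set_conv_list[symmetric])
  moreover have "(\<Sum>i\<leftarrow>sorted_list_of_set UNIV. p $ i) = mi_size p"
    unfolding mi_size_def by (simp add: sum.distinct_set_conv_list[symmetric])
  ultimately show "multi_partial p (wave g c) =
      wave (\<lambda>\<omega>. g \<omega> * mi_pow (v \<omega>) p) (\<lambda>\<omega>. c \<omega> + real (mi_size p) * (pi / 2))"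
    and "ess_bounded (\<lambda>\<omega>. g \<omega> * mi_pow (v \<omega>) p)"
    using foldr_partial_wave[OF assms, of p "sorted_list_of_set UNIV"] by (simp_all add: multi_partial_def)
qed

end

section \<open>The kernel as an average of cosine waves\<close>

lemma bochner_measure_cos:
  assumes "bochner_measure \<psi> \<Lambda>"
  shows "\<psi> z = (\<integral>\<omega>. cos (\<omega> \<bullet> z) \<partial>\<Lambda>)"
proof -
  interpret prob_space \<Lambda>
    using assms by (simp add: bochner_measure_def)
  have sets: "sets \<Lambda> = sets borel"
    using assms by (simp add: bochner_measure_def)
  have [measurable]: "(\<lambda>\<omega>. \<omega>) \<in> borel_measurable \<Lambda>"
    using sets by (simp cong: measurable_cong_sets)
  have "integrable \<Lambda> (\<lambda>\<omega>. exp (\<i> * complex_of_real (\<omega> \<bullet> z)))"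
    by (intro integrable_const_bound[where B = 1]) auto
  from integral_Re[OF this]
  have "(\<integral>\<omega>. cos (\<omega> \<bullet> z) \<partial>\<Lambda>) = Re (\<integral>\<omega>. exp (\<i> * complex_of_real (\<omega> \<bullet> z)) \<partial>\<Lambda>)"
    by (simp add: Re_exp)
  also have "\<dots> = Re (complex_of_real (\<psi> z))"
    using assms by (simp add: bochner_measure_def)
  finally show ?thesis
    by simp
qed

lemma mi_size_add: "mi_size (p + q) = mi_size p + mi_size q"
  by (simp add: mi_size_def sum.distrib)

lemma kernel_partial_eq_integral:
  fixes \<Lambda> :: "(real ^ 'n::{finite,linorder}) measure"
  assumes k: "\<And>x y. k x y = \<psi> (x - y)" and \<Lambda>: "bochner_measure \<psi> \<Lambda>"
    and bound: "p \<noteq> 0 \<or> q \<noteq> 0 \<Longrightarrow> AE \<omega> in \<Lambda>. norm \<omega> \<le> R"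
  shows "kernel_partial p q k x y =
    (\<integral>\<omega>. mi_pow \<omega> p * mi_pow (- \<omega>) q * h_fun (mi_size (p + q)) (\<omega> \<bullet> (x - y)) \<partial>\<Lambda>)"
proof (cases "p = 0 \<and> q = 0")
  \<comment> \<open>Without derivatives the formula is the cosine representation of
    \<open>\<psi>\<close>. The case stands apart because the bound \<open>R\<close> on the
    frequencies is available only when a derivative is taken.\<close>
  case True
  have "foldr (\<lambda>i. partial i ^^ 0) js f = f" for js :: "'n list" and f
    by (induction js) auto
  then show ?thesis
    using True bochner_measure_cos[OF \<Lambda>]
    by (simp add: kernel_partial_def multi_partial_def mi_pow_def mi_size_def h_fun_def k)
next
  case False
  interpret prob_space \<Lambda>
    using \<Lambda> by (simp add: bochner_measure_def)
  have sets: "sets \<Lambda> = sets borel"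
    using \<Lambda> by (simp add: bochner_measure_def)
  have ident [measurable]: "(\<lambda>\<omega>. \<omega>) \<in> borel_measurable \<Lambda>"
    using sets by (simp cong: measurable_cong_sets)
  interpret y: bounded_frequency \<Lambda> uminus R
    by standard (use bound False in auto)
  interpret x: bounded_frequency \<Lambda> "\<lambda>\<omega>. \<omega>" R
    by standard (use bound False in auto)
  have one: "y.ess_bounded (\<lambda>_. 1)"
    unfolding y.ess_bounded_def by (auto intro!: exI[of _ 1])
  have kx: "k x' = y.wave (\<lambda>_. 1) (\<lambda>\<omega>. \<omega> \<bullet> x')" for x'
    by (rule ext) (simp add: k bochner_measure_cos[OF \<Lambda>] y.wave_def inner_diff_right)
  \<comment> \<open>The roles of the arguments are exchanged here:
    \<open>\<omega> \<bullet> y\<close> joins the phase and \<open>x'\<close> becomes the variable,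
    so a wave with frequency \<open>- \<omega>\<close> is reread as one with frequency
    \<open>\<omega>\<close>.\<close>
  have "multi_partial q (k x') y = x.wave (\<lambda>\<omega>. mi_pow (- \<omega>) q) (\<lambda>\<omega>. real (mi_size q) * (pi / 2) - \<omega> \<bullet> y) x'" for x'
    unfolding kx by (subst y.multi_partial_wave[OF one]) (auto simp: y.wave_def x.wave_def algebra_simps)
  moreover have "x.ess_bounded (\<lambda>\<omega>. mi_pow (- \<omega>) q)"
    using y.multi_partial_wave(2)[OF one, of "\<lambda>_. 0" q] by (simp add: x.ess_bounded_def y.ess_bounded_def)
  ultimately have "kernel_partial p q k x y = x.wave (\<lambda>\<omega>. mi_pow (- \<omega>) q * mi_pow \<omega> p)
      (\<lambda>\<omega>. real (mi_size q) * (pi / 2) - \<omega> \<bullet> y + real (mi_size p) * (pi / 2)) x"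
    unfolding kernel_partial_def by (simp add: x.multi_partial_wave)
  then show ?thesis
    by (simp add: x.wave_def h_fun_def mi_size_add inner_diff_right algebra_simps add_divide_distrib)
qed

section \<open>Supports and monomials\<close>

lemma closed_msupp: "closed (msupp M)"
proof -
  have "- msupp M = \<Union> {V. open V \<and> emeasure M V = 0}"
    by (auto simp: msupp_def not_gr_zero)
  then show ?thesis
    unfolding closed_def by auto
qed

text \<open>A point outside the support has a null neighbourhood, hence lies in a null set of the
  basis; there are only countably many of these.\<close>

lemma AE_in_msupp:
  fixes M :: "'a::second_countable_topology measure"
  assumes "sets M = sets borel"
  shows "AE x in M. x \<in> msupp M"
proof -
  obtain B :: "'a set set" where B: "countable B" "topological_basis B"
    using ex_countable_basis by blast
  define N where "N = {b \<in> B. emeasure M b = 0}"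
  have "AE x in M. \<forall>b\<in>N. x \<notin> b"
  proof (rule AE_ball_countable[THEN iffD2])
    show "countable N"
      using B by (simp add: N_def)
    show "\<forall>b\<in>N. AE x in M. x \<notin> b"
    proof
      fix b assume "b \<in> N"
      then have "b \<in> null_sets M"
        using B assms by (auto simp: N_def null_sets_def topological_basis_open)
      then show "AE x in M. x \<notin> b"
        by (rule AE_not_in)
    qed
  qed
  then show ?thesis
  proof eventually_elim
    case (elim x)
    show ?case
      unfolding msupp_def
    proof safe
      fix V :: "'a set" assume "open V" "x \<in> V"
      then obtain b where b: "b \<in> B" "x \<in> b" "b \<subseteq> V"
        using B topological_basisE by blast
      then have "0 < emeasure M b"
        using elim by (auto simp: N_def not_gr_zero)
      also have "\<dots> \<le> emeasure M V"
        using b \<open>open V\<close> assms by (intro emeasure_mono) auto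
      finally show "0 < emeasure M V" .
    qed
  qed
qed

lemma mi_pow_add: "mi_pow v (p + q) = mi_pow v p * mi_pow v q"
  by (simp add: mi_pow_def power_add prod.distrib)

lemma mi_pow_double: "mi_pow v (2 * p) = (mi_pow v p)\<^sup>2"
  by (simp add: mi_pow_def power_mult[symmetric] prod_power_distrib mult.commute)

lemma abs_mi_pow_minus: "\<bar>mi_pow (- v) p\<bar> = \<bar>mi_pow v p\<bar>"
  by (simp add: mi_pow_def abs_prod power_abs)

lemma abs_mi_pow_le:
  assumes "norm v \<le> R"
  shows "\<bar>mi_pow v p\<bar> \<le> (\<Prod>j\<in>UNIV. R ^ (p $ j))"
proof -
  have "\<bar>v $ j\<bar> \<le> R" for j
    using component_le_norm_cart[of v j] assms by simp
  then show ?thesis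
    unfolding mi_pow_def abs_prod by (intro prod_mono) (auto simp: power_abs intro: power_mono)
qed

lemma borel_measurable_mi_pow [measurable (raw)]:
  assumes "f \<in> borel_measurable M"
  shows "(\<lambda>x. mi_pow (f x) p) \<in> borel_measurable M"
proof -
  have "(\<lambda>x. f x $ j) \<in> borel_measurable M" for j
    using borel_measurable_inner[OF assms borel_measurable_const[of "axis j 1"]]
    by (simp add: inner_axis)
  then show ?thesis
    unfolding mi_pow_def by (intro borel_measurable_prod borel_measurable_power)
qed

lemma T_const_upper:
  assumes "a + b \<noteq> 0 \<Longrightarrow> bounded (msupp \<Lambda>)" and "\<omega> \<in> msupp \<Lambda>"
  shows "\<bar>mi_pow \<omega> (a + b)\<bar> \<le> T_const \<Lambda> a b"
proof -
  have "bdd_above ((\<lambda>\<omega>. \<bar>mi_pow \<omega> (a + b)\<bar>) ` msupp \<Lambda>)"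
  proof (cases "a + b = 0")
    case True
    then show ?thesis
      by (intro bdd_aboveI2[where M = 1]) (simp add: mi_pow_def)
  next
    case False
    then obtain R where R: "\<And>\<omega>. \<omega> \<in> msupp \<Lambda> \<Longrightarrow> norm \<omega> \<le> R"
      using assms(1) bounded_iff by blast
    show ?thesis
      using abs_mi_pow_le[OF R] by (rule bdd_aboveI2)
  qed
  then show ?thesis
    unfolding T_const_def using assms(2) by (intro cSUP_upper)
qed

section \<open>Transfer of the tail bound to the kernel derivatives\<close>

theorem theorem4:
  fixes \<psi> :: "real ^ 'n::{finite,linorder} \<Rightarrow> real"
    and k :: "real ^ 'n::{finite,linorder} \<Rightarrow> real ^ 'n::{finite,linorder} \<Rightarrow> real"
    and \<Lambda> :: "(real ^ 'n::{finite,linorder}) measure"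
    and p q :: "nat ^ 'n::{finite,linorder}"
    and m :: nat
    and \<tau> :: real
    and S :: "(real ^ 'n::{finite,linorder}) set"
  assumes "\<And>x y. k x y = \<psi> (x - y)"
    and "bounded (range \<psi>)" and "continuous_on UNIV \<psi>" and "pos_def \<psi>" and "\<psi> 0 = 1"
    and "bochner_measure \<psi> \<Lambda>"
    and "integrable \<Lambda> (\<lambda>\<omega>. \<bar>mi_pow \<omega> (2 * p + 2 * q)\<bar> * (norm \<omega>)\<^sup>2)"
    and "T_const \<Lambda> (2 * p) (2 * q) > 0"
    and "p \<noteq> 0 \<or> q \<noteq> 0 \<Longrightarrow> bounded (msupp \<Lambda>)"
    and "m \<ge> 1"
    and "\<tau> > 0"
    and "compact S" and "S \<noteq> {}"
  shows "measure (\<Pi>\<^sub>M j\<in>{..<m}. \<Lambda>)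
           {\<omega> \<in> space (\<Pi>\<^sub>M j\<in>{..<m}. \<Lambda>).
              ereal (sup_norm S (\<lambda>x y. kernel_partial p q k x y - rff m p q \<omega> x y))
              \<ge> (H_const \<Lambda> p q (diameter S) + ereal (T_const \<Lambda> p q * sqrt (2 * \<tau>)))
                 / ereal (sqrt (real m))}
         \<le> exp (- \<tau>)"
proof -
  note k = assms(1) and \<Lambda> = assms(6) and int = assms(7) and T2_pos = assms(8) and supp_bdd = assms(9)
  let ?P = "Pi\<^sub>M {..<m} (\<lambda>_. \<Lambda>)"
  interpret prob_space \<Lambda>
    using \<Lambda> by (simp add: bochner_measure_def)
  interpret P: prob_space ?P by (intro prob_space_PiM prob_space_axioms)
  have sets: "sets \<Lambda> = sets borel"
    using \<Lambda> by (simp add: bochner_measure_def)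
  have AE_supp: "AE \<omega> in \<Lambda>. \<omega> \<in> msupp \<Lambda>"
    using sets by (rule AE_in_msupp)
  define T where "T = T_const \<Lambda> p q"
  define r where "r = diameter S"
  define n where "n = mi_size (p + q)"
  \<comment> \<open>Cutting the features off outside the support makes the bound by \<open>T\<close> hold everywhere.\<close>
  define w where "w \<omega> = indicator (msupp \<Lambda>) \<omega> * (mi_pow \<omega> p * mi_pow (- \<omega>) q)" for \<omega>
  define f where "f z \<omega> = w \<omega> * h_fun n (\<omega> \<bullet> z)" for z \<omega>
  have abs_pow: "\<bar>mi_pow \<omega> p * mi_pow (- \<omega>) q\<bar> = \<bar>mi_pow \<omega> (p + q)\<bar>" for \<omega> :: "(real, 'n) vec"
    by (simp add: abs_mult abs_mi_pow_minus mi_pow_add)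
  have pow_double: "mi_pow \<omega> (2 * p + 2 * q) = (mi_pow \<omega> (p + q))\<^sup>2" for \<omega> :: "(real, 'n) vec"
    by (simp add: mi_pow_add mi_pow_double power_mult_distrib)
  have pq: "p \<noteq> 0 \<or> q \<noteq> 0" if "p + q \<noteq> 0 \<or> 2 * p + 2 * q \<noteq> 0"
    using that by auto
  have T_upper: "\<bar>mi_pow \<omega> (p + q)\<bar> \<le> T" if "\<omega> \<in> msupp \<Lambda>" for \<omega>
    unfolding T_def using that supp_bdd pq by (intro T_const_upper) auto
  have T2_upper: "(mi_pow \<omega> (p + q))\<^sup>2 \<le> T_const \<Lambda> (2 * p) (2 * q)" if "\<omega> \<in> msupp \<Lambda>" for \<omega>
    using T_const_upper[of "2 * p" "2 * q" \<Lambda> \<omega>] that supp_bdd pq by (auto simp: pow_double)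
  have supp_ne: "msupp \<Lambda> \<noteq> {}"
    using AE_supp by (auto simp: AE_False)
  have T0: "0 \<le> T"
    using T_upper supp_ne order_trans[OF abs_ge_zero] by blast
  \<comment> \<open>The supremum of the squares is the square of the supremum. This reconciles the
    constants of the claim, stated with doubled exponents, with the single amplitude bound
    \<open>T\<close> of the tail estimate.\<close>
  have T2: "T_const \<Lambda> (2 * p) (2 * q) = T\<^sup>2"
  proof (rule antisym)
    show "T_const \<Lambda> (2 * p) (2 * q) \<le> T\<^sup>2"
      unfolding T_const_def pow_double using T_upper T0
      by (intro cSUP_least supp_ne) (simp add: abs_le_square_iff[symmetric])
    have "T \<le> sqrt (T_const \<Lambda> (2 * p) (2 * q))"
      unfolding T_def T_const_def[of _ p q] using T2_upper
      by (intro cSUP_least supp_ne) (simp add: real_le_rsqrt)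
    then show "T\<^sup>2 \<le> T_const \<Lambda> (2 * p) (2 * q)"
      using T0 T2_pos by (metis less_imp_le power_mono real_sqrt_pow2)
  qed
  then have T_pos: "0 < T"
    using T0 T2_pos by (cases "T = 0") auto
  have r0: "0 \<le> r"
    unfolding r_def using \<open>compact S\<close> by (intro diameter_ge_0 compact_imp_bounded)
  define U where "U = ln (1 + 2 * r / T)"
  have U_eq: "U_const \<Lambda> p q (diameter S) = U"
    using T_pos by (simp add: U_const_def U_def r_def T2 powr_minus_divide powr_half_sqrt add.commute)
  have U0: "0 \<le> U"
    using r0 T_pos by (simp add: U_def)
  define C where "C = C_const \<Lambda> (2 * p) (2 * q)"
  show ?thesis
  proof (cases "U = 0")
    \<comment> \<open>This is the case of diameter 0: the threshold is infinite, so the event is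
      empty.\<close>
    case True
    then have "H_const \<Lambda> p q (diameter S) = \<infinity>"
      using T_pos by (simp add: H_const_def U_eq T2)
    then show ?thesis
      using \<open>1 \<le> m\<close> by simp
  next
    case False
    then have U_pos: "0 < U"
      using U0 by simp
    define H where "H = 32 * (T * (sqrt (2 * real DIM((real, 'n) vec)) * (sqrt U + 1 / (2 * sqrt U) + sqrt (ln (1 + sqrt C)))))"
    have H_eq: "H_const \<Lambda> p q (diameter S) = ereal H"
    proof -
      have "sqrt (2 * real CARD('n) * T\<^sup>2) = T * sqrt (2 * real DIM((real, 'n) vec))"
        using T_pos by (simp add: real_sqrt_mult)
      then show ?thesis
        using U_pos unfolding H_const_def U_eq T2 C_def[symmetric]
        by (simp add: H_def one_ereal_def add.commute)
    qed
    define D where "D = (\<lambda>(x, y). x - y) ` (S \<times> S)"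
    have D: "D \<noteq> {}" "D \<subseteq> cball 0 r"
      using \<open>S \<noteq> {}\<close> diameter_bounded_bound[OF compact_imp_bounded[OF \<open>compact S\<close>]]
      by (auto simp: D_def r_def dist_norm)
    have supp_meas [measurable]: "msupp \<Lambda> \<in> sets borel"
      using closed_msupp by (rule borel_closed)
    have w_meas: "w \<in> borel_measurable borel"
      unfolding w_def[abs_def] by measurable
    have w_le: "\<bar>w \<omega>\<bar> \<le> T" for \<omega>
      using T_upper[of \<omega>] T0 by (cases "\<omega> \<in> msupp \<Lambda>") (auto simp: w_def abs_pow)
    \<comment> \<open>Identifies the constant \<open>C\<close> of the claim with the second moment
      that governs \<open>L\<close> for the cut-off amplitude.\<close>
    have w2: "AE \<omega> in \<Lambda>. \<bar>mi_pow \<omega> (2 * p + 2 * q)\<bar> * (norm \<omega>)\<^sup>2 = (w \<omega>)\<^sup>2 * (norm \<omega>)\<^sup>2"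
      using AE_supp
    proof eventually_elim
      case (elim \<omega>)
      then have "(w \<omega>)\<^sup>2 = \<bar>mi_pow \<omega> p * mi_pow (- \<omega>) q\<bar>\<^sup>2"
        by (simp add: w_def)
      then show ?case
        by (simp add: abs_pow pow_double)
    qed
    have [measurable]: "(\<lambda>\<omega>. \<omega>) \<in> borel_measurable \<Lambda>" "w \<in> borel_measurable \<Lambda>"
      using sets w_meas by (simp_all cong: measurable_cong_sets)
    have int_w: "integrable \<Lambda> (\<lambda>\<omega>. (w \<omega>)\<^sup>2 * (norm \<omega>)\<^sup>2)"
      using int w2 by (subst (asm) integrable_cong_AE) auto
    have C: "C = (\<integral>\<omega>. (w \<omega>)\<^sup>2 * (norm \<omega>)\<^sup>2 \<partial>\<Lambda>)"
      unfolding C_def C_const_def using w2 by (intro integral_cong_AE) auto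
    have h_lip: "\<bar>h_fun n x - h_fun n y\<bar> \<le> \<bar>x - y\<bar>" for x y
      using abs_cos_diff_le[of "pi * real n / 2 + x" "pi * real n / 2 + y"] by (simp add: h_fun_def)
    have h_le: "\<bar>h_fun n x\<bar> \<le> 1" for x
      by (simp add: h_fun_def)
    define E where "E = {x \<in> space ?P. sqrt m * (H + T * sqrt (2 * \<tau>)) \<le>
        (SUP z\<in>D. \<bar>\<Sum>j<m. f z (x j) - integral\<^sup>L \<Lambda> (f z)\<bar>)}"
    have E: "E \<in> sets ?P" "measure ?P E \<le> exp (- \<tau>)"
      unfolding E_def f_def[abs_def]
      using feature_deviation_tail[OF prob_space_axioms sets w_meas w_le h_lip h_le D _ T_pos r0 \<open>0 < \<tau>\<close>
          U_def U_pos int_w C H_def] \<open>1 \<le> m\<close> by simp_all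
    \<comment> \<open>For \<open>p = q = 0\<close> the implication holds vacuously and any
      \<open>R\<close> is a witness.\<close>
    obtain R where R: "p \<noteq> 0 \<or> q \<noteq> 0 \<Longrightarrow> AE \<omega> in \<Lambda>. norm \<omega> \<le> R"
    proof (cases "p \<noteq> 0 \<or> q \<noteq> 0")
      case True
      then obtain R where "\<forall>\<omega>\<in>msupp \<Lambda>. norm \<omega> \<le> R"
        using supp_bdd bounded_iff by blast
      then have "AE \<omega> in \<Lambda>. norm \<omega> \<le> R"
        using AE_supp by auto
      then show ?thesis
        by (rule that)
    qed (use that in blast)
    have kernel: "kernel_partial p q k x y = integral\<^sup>L \<Lambda> (f (x - y))" for x y
    proof -
      have "kernel_partial p q k x y =
          (\<integral>\<omega>. mi_pow \<omega> p * mi_pow (- \<omega>) q * h_fun n (\<omega> \<bullet> (x - y)) \<partial>\<Lambda>)"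
        unfolding n_def using k \<Lambda> R by (rule kernel_partial_eq_integral)
      also have "\<dots> = integral\<^sup>L \<Lambda> (f (x - y))"
      proof (rule integral_cong_AE)
        show "AE \<omega> in \<Lambda>. mi_pow \<omega> p * mi_pow (- \<omega>) q * h_fun n (\<omega> \<bullet> (x - y)) = f (x - y) \<omega>"
          using AE_supp by eventually_elim (simp add: f_def w_def)
      qed (simp_all add: f_def[abs_def] h_fun_def)
      finally show ?thesis .
    qed
    have f_bound: "\<bar>f z \<omega>\<bar> \<le> T" for z \<omega>
      using mult_mono[OF w_le[of \<omega>] h_le[of "\<omega> \<bullet> z"]] T0 by (simp add: f_def abs_mult)
    have f_int: "integrable \<Lambda> (f z)" for z
    proof (rule integrable_const_bound[where B = T])
      show "f z \<in> borel_measurable \<Lambda>"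
        unfolding f_def[abs_def] h_fun_def by measurable
    qed (simp add: f_bound)
    have Ef_bound: "\<bar>integral\<^sup>L \<Lambda> (f z)\<bar> \<le> T" for z
    proof -
      have "\<bar>integral\<^sup>L \<Lambda> (f z)\<bar> \<le> (\<integral>y. T \<partial>\<Lambda>)"
        using f_int f_bound by (intro order_trans[OF integral_abs_bound] integral_mono) auto
      then show ?thesis
        by (simp add: prob_space)
    qed
    \<comment> \<open>On samples inside the support the cut-off amplitude is the original one, so
      \<open>rff\<close> is exactly the empirical mean of the features \<open>f\<close>.\<close>
    have sup_le: "sup_norm S (\<lambda>x y. kernel_partial p q k x y - rff m p q \<omega> x y) \<le>
        (SUP z\<in>D. \<bar>\<Sum>j<m. f z (\<omega> j) - integral\<^sup>L \<Lambda> (f z)\<bar>) / m"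
      if supp: "\<forall>j<m. \<omega> j \<in> msupp \<Lambda>" for \<omega>
    proof -
      have diff: "\<bar>kernel_partial p q k x y - rff m p q \<omega> x y\<bar> =
          \<bar>\<Sum>j<m. f (x - y) (\<omega> j) - integral\<^sup>L \<Lambda> (f (x - y))\<bar> / m" for x y
      proof -
        have "rff m p q \<omega> x y = (\<Sum>j<m. f (x - y) (\<omega> j)) / m"
          unfolding rff_def f_def w_def n_def using supp by (simp add: mult.assoc)
        then have "rff m p q \<omega> x y - kernel_partial p q k x y =
            (\<Sum>j<m. f (x - y) (\<omega> j) - integral\<^sup>L \<Lambda> (f (x - y))) / m"
          using \<open>1 \<le> m\<close> by (simp add: kernel sum_subtractf diff_divide_distrib)
        then show ?thesis
          by (metis abs_divide abs_minus_commute abs_of_nat)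
      qed
      let ?g = "\<lambda>z. \<bar>\<Sum>j<m. f z (\<omega> j) - integral\<^sup>L \<Lambda> (f z)\<bar>"
      have "sup_norm S (\<lambda>x y. kernel_partial p q k x y - rff m p q \<omega> x y) = (SUP z\<in>D. ?g z / m)"
        unfolding sup_norm_def D_def image_image by (simp add: diff case_prod_unfold)
      also have "\<dots> \<le> (SUP z\<in>D. ?g z) / m"
      proof (intro cSUP_least D divide_right_mono cSUP_upper)
        show "bdd_above (?g ` D)"
        proof (rule bdd_aboveI2)
          fix z
          have "?g z \<le> (\<Sum>j<m. \<bar>f z (\<omega> j) - integral\<^sup>L \<Lambda> (f z)\<bar>)"
            by (rule sum_abs)
          also have "\<dots> \<le> (\<Sum>j<m. 2 * T)"
          proof (rule sum_mono)
            show "\<bar>f z (\<omega> j) - integral\<^sup>L \<Lambda> (f z)\<bar> \<le> 2 * T" for j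
              using f_bound[of z "\<omega> j"] Ef_bound[of z] by simp
          qed
          finally show "?g z \<le> (\<Sum>j<m. 2 * T)" .
        qed
      qed auto
      finally show ?thesis .
    qed
    have AE_P: "AE \<omega> in ?P. \<forall>j<m. \<omega> j \<in> msupp \<Lambda>"
    proof -
      have "AE \<omega> in ?P. \<forall>j\<in>{..<m}. \<omega> j \<in> msupp \<Lambda>"
        using AE_supp prob_space_axioms by (intro AE_finite_allI AE_PiM_component) auto
      then show ?thesis
        by eventually_elim auto
    qed
    show ?thesis
    \<comment> \<open>Only \<open>E\<close> is shown to be measurable. The event of the claim lies
      in \<open>E\<close> up to the null set of samples that leave the support, which is enough to
      compare the measures.\<close>
    proof (rule order_trans[OF P.finite_measure_mono_AE E(2)])
      show "AE \<omega> in ?P. \<omega> \<in> {\<omega> \<in> space ?P.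
            ereal (sup_norm S (\<lambda>x y. kernel_partial p q k x y - rff m p q \<omega> x y))
            \<ge> (H_const \<Lambda> p q (diameter S) + ereal (T_const \<Lambda> p q * sqrt (2 * \<tau>))) / ereal (sqrt (real m))}
          \<longrightarrow> \<omega> \<in> E"
        using AE_P
      proof eventually_elim
        case (elim \<omega>)
        let ?k = "sup_norm S (\<lambda>x y. kernel_partial p q k x y - rff m p q \<omega> x y)"
        let ?s = "SUP z\<in>D. \<bar>\<Sum>j<m. f z (\<omega> j) - integral\<^sup>L \<Lambda> (f z)\<bar>"
        have "sqrt m * (H + T * sqrt (2 * \<tau>)) \<le> ?s" if "(H + T * sqrt (2 * \<tau>)) / sqrt m \<le> ?k"
        proof -
          \<comment> \<open>\<open>E\<close> is phrased for sums rather than means; multiplying by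
            \<open>m\<close> turns the divisor \<open>sqrt m\<close> into a factor
            \<open>sqrt m\<close>.\<close>
          have "(H + T * sqrt (2 * \<tau>)) / sqrt m * m \<le> ?s / m * m"
            using order_trans[OF that sup_le[OF elim]] by (rule mult_right_mono) simp
          also have "(H + T * sqrt (2 * \<tau>)) / sqrt m * m = (H + T * sqrt (2 * \<tau>)) * (m / sqrt m)"
            by simp
          also have "\<dots> = sqrt m * (H + T * sqrt (2 * \<tau>))"
            unfolding real_div_sqrt[OF of_nat_0_le_iff] by (rule mult.commute)
          finally show ?thesis
            using \<open>1 \<le> m\<close> by simp
        qed
        then show ?case
          using \<open>1 \<le> m\<close> by (auto simp: E_def H_eq T_def)
      qed
    qed (rule E)
  qed
qed

end
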